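(* For a positive integer $n$, there exists an omniversal Latin square of order $n$ if and only if $n\notin\{3,4\}$ and $n\not\equiv 2 \pmod 4$.
   Context: A Latin square of order $n$ is an $n\times n$ array on $n$ symbols in which each row and each column contains each symbol exactly once; it is viewed as the set of triples $(r,c,s)$ where $s$ is the symbol in cell $(r,c)$. A partial transversal is a set of triples of the Latin square containing at most one triple in each row, at most one in each column, and at most one with each symbol; its length is its number of triples. It is maximal if it is not contained in a partial transversal of greater length. Every maximal partial transversal of a Latin square of order $n$ has length $\ell$ with $\lceil n/2\rceil\le \ell\le n$. A Latin square of order $n$ is omniversal if it has a maximal partial transversal of every length $\ell$ with $\lceil n/2\rceil\le \ell\le n$. *)

theory Defs
  imports Complex_Main
begin

text \<open>Rows, columns and symbols of a Latin square of order \<open>n\<close> are indexed by \<open>{..<n}\<close>;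
  the values of the array \<open>L\<close> outside \<open>{..<n} \<times> {..<n}\<close> are irrelevant.\<close>

definition latin_square :: "nat \<Rightarrow> (nat \<Rightarrow> nat \<Rightarrow> nat) \<Rightarrow> bool" where
  "latin_square n L \<longleftrightarrow>
     (\<forall>r<n. \<forall>c<n. L r c < n) \<and>
     (\<forall>r<n. \<forall>s<n. \<exists>!c. c < n \<and> L r c = s) \<and>
     (\<forall>c<n. \<forall>s<n. \<exists>!r. r < n \<and> L r c = s)"

definition triples :: "nat \<Rightarrow> (nat \<Rightarrow> nat \<Rightarrow> nat) \<Rightarrow> (nat \<times> nat \<times> nat) set" where
  "triples n L = {(r, c, s). r < n \<and> c < n \<and> s = L r c}"

definition partial_transversal ::
  "nat \<Rightarrow> (nat \<Rightarrow> nat \<Rightarrow> nat) \<Rightarrow> (nat \<times> nat \<times> nat) set \<Rightarrow> bool" where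
  "partial_transversal n L T \<longleftrightarrow>
     T \<subseteq> triples n L \<and>
     inj_on (\<lambda>(r, c, s). r) T \<and>
     inj_on (\<lambda>(r, c, s). c) T \<and>
     inj_on (\<lambda>(r, c, s). s) T"

definition maximal_partial_transversal ::
  "nat \<Rightarrow> (nat \<Rightarrow> nat \<Rightarrow> nat) \<Rightarrow> (nat \<times> nat \<times> nat) set \<Rightarrow> bool" where
  "maximal_partial_transversal n L T \<longleftrightarrow>
     partial_transversal n L T \<and>
     \<not> (\<exists>T'. partial_transversal n L T' \<and> T \<subseteq> T' \<and> card T < card T')"

definition omniversal :: "nat \<Rightarrow> (nat \<Rightarrow> nat \<Rightarrow> nat) \<Rightarrow> bool" where
  "omniversal n L \<longleftrightarrow>
     latin_square n L \<and>
     (\<forall>l::nat. \<lceil>real n / 2\<rceil> \<le> int l \<and> l \<le> n \<longrightarrow>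
        (\<exists>T. maximal_partial_transversal n L T \<and> card T = l))"

end

theory Submission
  imports Defs
begin

text \<open>A partial transversal of length \<open>n - d\<close> is maximal iff the \<open>d \<times> d\<close> subarray formed by its
  unused rows and columns avoids the \<open>d\<close> unused symbols. For \<open>2 * d = n\<close> this forces the square to
  split into four subsquares of order \<open>d\<close>, and counting incidences modulo 2 shows that no transversal
  can coexist with such a splitting when \<open>d\<close> is odd. A Latin square of order 4 with a transversal
  is, up to relabelling, one of two idempotent squares, in which three compatible cells always extend.

  For odd \<open>n = 2 * m - 1\<close> we use a square with a subsquare \<open>D\<close> of order \<open>m - 1\<close>, built from
  \<open>(i + j) / 2\<close> modulo an odd number; every partial transversal whose unused rows and columns meet in
  \<open>D\<close> and which uses all symbols of \<open>D\<close> is maximal. For \<open>n = 4 * h\<close> parity obstructs a single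
  splitting into four blocks. The square is therefore a \<open>4 \<times> 4\<close> array of blocks of order \<open>h\<close> that
  follows the Klein four-group, so that it splits in two ways into blocks of order \<open>2 * h\<close>. One of
  the splittings serves even \<open>d\<close>; one switched intercalate breaks the other, which then serves odd
  \<open>d\<close>. All blocks are relabellings of one idempotent square, so that the partial transversals can be
  assembled from diagonal cells, orbit by orbit.\<close>

section \<open>Maximal partial transversals\<close>

text \<open>Why parity matters for order \<open>4 * h\<close>: in a square split into four blocks,
  every triple has an odd number of its row, column and symbol in the distinguished halves. Yet
  length \<open>2 * h\<close> forces an exact splitting, so one splitting has to survive intact. The
  two splittings are those by the classes \<open>{0, 1}\<close> and \<open>{0, 2}\<close>. The
  intercalate lies in the blocks of classes 0 and 1, and switching it exchanges these two symbol
  classes: this respects the first splitting, while in the second the four switched cells get an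
  even number of incidences. A partial transversal contains at most one cell of an intercalate, and
  containing one flips the parity, as odd \<open>d\<close> requires. The price is that the switched
  cell in block \<open>(1, 1)\<close> is no longer blocked by its symbol class, so its row must be
  used.\<close>

definition unextendable_pt ::
  "'a set \<Rightarrow> 'b set \<Rightarrow> ('a \<Rightarrow> 'b \<Rightarrow> 'c) \<Rightarrow> ('a \<times> 'b \<times> 'c) set \<Rightarrow> bool" where
  "unextendable_pt X Y L T \<longleftrightarrow>
     (\<forall>x y z. (x, y, z) \<in> T \<longrightarrow> x \<in> X \<and> y \<in> Y \<and> z = L x y) \<and>
     (\<forall>x y z x' y' z'. (x, y, z) \<in> T \<longrightarrow> (x', y', z') \<in> T \<longrightarrow>
        x = x' \<or> y = y' \<or> z = z' \<longrightarrow> x = x' \<and> y = y' \<and> z = z') \<and>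
     (\<forall>x y. x \<in> X \<longrightarrow> y \<in> Y \<longrightarrow> (\<exists>x' y' z'. (x', y', z') \<in> T \<and> (x = x' \<or> y = y' \<or> L x y = z')))"

lemma partial_transversal_iff:
  "partial_transversal n L T \<longleftrightarrow>
     (\<forall>x y z. (x, y, z) \<in> T \<longrightarrow> x < n \<and> y < n \<and> z = L x y) \<and>
     (\<forall>x y z x' y' z'. (x, y, z) \<in> T \<longrightarrow> (x', y', z') \<in> T \<longrightarrow>
        x = x' \<or> y = y' \<or> z = z' \<longrightarrow> x = x' \<and> y = y' \<and> z = z')" (is "_ \<longleftrightarrow> ?P \<and> ?Q")
proof -
  have "T \<subseteq> triples n L \<longleftrightarrow> ?P"
    by (simp add: triples_def subset_iff split_paired_All)
  moreover have "inj_on (\<lambda>(r, c, s). r) T \<longleftrightarrow> (\<forall>x y z x' y' z'. (x, y, z) \<in> T \<longrightarrow> (x', y', z') \<in> T \<longrightarrow>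
       x = x' \<longrightarrow> y = y' \<and> z = z')"
    "inj_on (\<lambda>(r, c, s). c) T \<longleftrightarrow> (\<forall>x y z x' y' z'. (x, y, z) \<in> T \<longrightarrow> (x', y', z') \<in> T \<longrightarrow>
       y = y' \<longrightarrow> x = x' \<and> z = z')"
    "inj_on (\<lambda>(r, c, s). s) T \<longleftrightarrow> (\<forall>x y z x' y' z'. (x, y, z) \<in> T \<longrightarrow> (x', y', z') \<in> T \<longrightarrow>
       z = z' \<longrightarrow> x = x' \<and> y = y')"
    by (auto simp: inj_on_def)
  ultimately have *: "partial_transversal n L T \<longleftrightarrow> ?P \<and>
      (\<forall>x y z x' y' z'. (x, y, z) \<in> T \<longrightarrow> (x', y', z') \<in> T \<longrightarrow>
        (x = x' \<longrightarrow> y = y' \<and> z = z') \<and> (y = y' \<longrightarrow> x = x' \<and> z = z') \<and> (z = z' \<longrightarrow> x = x' \<and> y = y'))"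
    unfolding partial_transversal_def by (simp only: all_conj_distrib imp_conjR)
  have e: "(x = x' \<longrightarrow> y = y' \<and> z = z') \<and> (y = y' \<longrightarrow> x = x' \<and> z = z') \<and> (z = z' \<longrightarrow> x = x' \<and> y = y') \<longleftrightarrow>
      (x = x' \<or> y = y' \<or> z = z' \<longrightarrow> x = x' \<and> y = y' \<and> z = z')" for x x' y y' z z' :: nat
    by (cases "x = x'"; cases "y = y'"; cases "z = z'"; simp)
  show ?thesis unfolding * e ..
qed

lemma unextendable_pt_iff:
  "unextendable_pt {..<n} {..<n} L T \<longleftrightarrow> partial_transversal n L T \<and>
     (\<forall>x y. x < n \<longrightarrow> y < n \<longrightarrow> (\<exists>x' y' z'. (x', y', z') \<in> T \<and> (x = x' \<or> y = y' \<or> L x y = z')))"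
  by (simp only: unextendable_pt_def partial_transversal_iff lessThan_iff conj_assoc)

lemma partial_transversal_finite:
  assumes "partial_transversal n L T"
  shows "finite T"
proof (rule finite_subset)
  show "T \<subseteq> triples n L" using assms by (simp add: partial_transversal_def)
  have "triples n L \<subseteq> {..<n} \<times> {..<n} \<times> (\<lambda>(r, c). L r c) ` ({..<n} \<times> {..<n})"
    by (auto simp: triples_def)
  then show "finite (triples n L)" by (rule finite_subset) simp
qed

text \<open>A cell that avoids all used rows, columns and symbols could be inserted. Conversely, a
  further triple of a larger partial transversal would share a coordinate with a triple of
  \<open>T\<close>, and would therefore be that triple.\<close>

lemma maximal_partial_transversal_iff:
  "maximal_partial_transversal n L T \<longleftrightarrow> unextendable_pt {..<n} {..<n} L T"
proof
  assume max: "maximal_partial_transversal n L T"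
  then have pt: "partial_transversal n L T" by (simp add: maximal_partial_transversal_def)
  have "\<exists>x' y' z'. (x', y', z') \<in> T \<and> (x = x' \<or> y = y' \<or> L x y = z')" if xy: "x < n" "y < n" for x y
  proof (rule ccontr)
    assume *: "\<not> ?thesis"
    let ?T = "insert (x, y, L x y) T"
    have new: "(x, y, L x y) \<notin> T" using * by blast
    have "partial_transversal n L ?T"
      using pt xy * unfolding partial_transversal_iff insert_iff prod.inject by metis
    moreover have "card T < card ?T"
      using new partial_transversal_finite[OF pt] by simp
    ultimately show False using max unfolding maximal_partial_transversal_def by blast
  qed
  then show "unextendable_pt {..<n} {..<n} L T"
    using pt unfolding unextendable_pt_iff by blast
next
  assume T: "unextendable_pt {..<n} {..<n} L T"
  then have pt: "partial_transversal n L T" by (simp add: unextendable_pt_iff)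
  have False if T': "partial_transversal n L T'" "T \<subseteq> T'" "card T < card T'" for T'
  proof -
    have "T \<noteq> T'" using T'(3) by blast
    then obtain x y z where t: "(x, y, z) \<in> T'" "(x, y, z) \<notin> T"
      using T'(2) by auto
    have "x < n" "y < n" "z = L x y" using t(1) T'(1) by (auto simp: partial_transversal_iff)
    then obtain x' y' z' where t': "(x', y', z') \<in> T" "x = x' \<or> y = y' \<or> z = z'"
      using T unfolding unextendable_pt_iff by blast
    then have "(x', y', z') \<in> T'" using T'(2) by blast
    then have "x = x' \<and> y = y' \<and> z = z'"
      using t(1) t'(2) T'(1) unfolding partial_transversal_iff by blast
    then show False using t(2) t'(1) by simp
  qed
  then show "maximal_partial_transversal n L T"
    using pt unfolding maximal_partial_transversal_def by blast
qed

lemma omniversal_iff: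
  "omniversal n L \<longleftrightarrow> latin_square n L \<and>
     (\<forall>d. 2 * d \<le> n \<longrightarrow> (\<exists>T. unextendable_pt {..<n} {..<n} L T \<and> card T + d = n))"
proof -
  have ceil: "\<lceil>real n / 2\<rceil> \<le> int l \<longleftrightarrow> n \<le> 2 * l" for l
  proof -
    have "real n / 2 \<le> real l \<longleftrightarrow> real n \<le> real (2 * l)" by auto
    then show ?thesis by (simp only: ceiling_le_iff of_int_of_nat_eq of_nat_le_iff)
  qed
  have "(\<forall>l. \<lceil>real n / 2\<rceil> \<le> int l \<and> l \<le> n \<longrightarrow> P l) \<longleftrightarrow> (\<forall>d. 2 * d \<le> n \<longrightarrow> P (n - d))" for P
  proof (intro iffI allI impI)
    fix d assume "\<forall>l. \<lceil>real n / 2\<rceil> \<le> int l \<and> l \<le> n \<longrightarrow> P l" "2 * d \<le> n"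
    then show "P (n - d)" unfolding ceil by auto
  next
    fix l assume *: "\<forall>d. 2 * d \<le> n \<longrightarrow> P (n - d)" "\<lceil>real n / 2\<rceil> \<le> int l \<and> l \<le> n"
    then have "n \<le> 2 * l" "l \<le> n" unfolding ceil by auto
    then have "2 * (n - l) \<le> n" "n - (n - l) = l" by auto
    then show "P l" using * by metis
  qed
  note eq = this
  have card: "card T = n - d \<longleftrightarrow> card T + d = n" if "2 * d \<le> n" for T :: "(nat \<times> nat \<times> nat) set" and d
    using that by auto
  show ?thesis
    unfolding omniversal_def maximal_partial_transversal_iff eq by (simp add: card cong: imp_cong)
qed

lemma latin_squareI:
  assumes "\<And>r c. r < n \<Longrightarrow> c < n \<Longrightarrow> L r c < n"
    and "\<And>r. r < n \<Longrightarrow> inj_on (L r) {..<n}"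
    and "\<And>c. c < n \<Longrightarrow> inj_on (\<lambda>r. L r c) {..<n}"
  shows "latin_square n L"
proof -
  have "L r ` {..<n} = {..<n}" if "r < n" for r
    using assms(1,2) that by (intro card_subset_eq) (auto simp: card_image)
  moreover have "(\<lambda>r. L r c) ` {..<n} = {..<n}" if "c < n" for c
    using assms(1,3) that by (intro card_subset_eq) (auto simp: card_image)
  ultimately have ex: "\<exists>c. c < n \<and> L r c = s" "\<exists>c. c < n \<and> L c r = s" if "r < n" "s < n" for r s
    using that by (metis imageE lessThan_iff)+
  have "\<exists>!c. c < n \<and> L r c = s" if "r < n" "s < n" for r s
    using ex(1)[OF that] by (rule ex_ex1I) (use inj_onD[OF assms(2)[OF that(1)]] in auto)
  moreover have "\<exists>!r. r < n \<and> L r c = s" if "c < n" "s < n" for c s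
    using ex(2)[OF that] by (rule ex_ex1I) (use inj_onD[OF assms(3)[OF that(1)]] in auto)
  ultimately show ?thesis
    using assms(1) unfolding latin_square_def by simp
qed

lemma latin_square_inj:
  assumes "latin_square n L"
  shows "r < n \<Longrightarrow> inj_on (L r) {..<n}" "c < n \<Longrightarrow> inj_on (\<lambda>r. L r c) {..<n}"
proof -
  have L: "\<And>r c. r < n \<Longrightarrow> c < n \<Longrightarrow> L r c < n"
    and 1: "\<And>r s. r < n \<Longrightarrow> s < n \<Longrightarrow> \<exists>!c. c < n \<and> L r c = s"
    and 2: "\<And>c s. c < n \<Longrightarrow> s < n \<Longrightarrow> \<exists>!r. r < n \<and> L r c = s"
    using assms by (simp_all add: latin_square_def)
  show "inj_on (L r) {..<n}" if "r < n"
  proof (rule inj_onI)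
    fix x y assume xy: "x \<in> {..<n}" "y \<in> {..<n}" "L r x = L r y"
    have "\<exists>!c. c < n \<and> L r c = L r x" using 1[OF that L[OF that]] xy by simp
    then show "x = y" using xy by auto
  qed
  show "inj_on (\<lambda>r. L r c) {..<n}" if "c < n"
  proof (rule inj_onI)
    fix x y assume xy: "x \<in> {..<n}" "y \<in> {..<n}" "L x c = L y c"
    have "\<exists>!r. r < n \<and> L r c = L x c" using 2[OF that L[OF _ that]] xy by simp
    then show "x = y" using xy by auto
  qed
qed

text \<open>Transport along bijections with \<open>{..<n}\<close>. The odd orders use disjoint sums
  as index sets and the orders \<open>4 * h\<close> use pairs; only the cardinalities
  matter.\<close>

lemma ex_omniversal:
  fixes L :: "'a \<Rightarrow> 'b \<Rightarrow> 'c"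
  assumes fin: "finite X" "finite Y" "finite Z" and card: "card X = n" "card Y = n" "card Z = n"
    and L: "\<And>x y. x \<in> X \<Longrightarrow> y \<in> Y \<Longrightarrow> L x y \<in> Z"
      "\<And>x. x \<in> X \<Longrightarrow> inj_on (L x) Y" "\<And>y. y \<in> Y \<Longrightarrow> inj_on (\<lambda>x. L x y) X"
    and T: "\<And>d. 2 * d \<le> n \<Longrightarrow> \<exists>T. unextendable_pt X Y L T \<and> card T + d = n"
  shows "\<exists>L. omniversal n L"
proof -
  obtain f where f: "bij_betw f X {..<n}" using ex_bij_betw_finite_nat[OF fin(1)] card by (auto simp: atLeast0LessThan)
  obtain g where g: "bij_betw g Y {..<n}" using ex_bij_betw_finite_nat[OF fin(2)] card by (auto simp: atLeast0LessThan)
  obtain h where h: "bij_betw h Z {..<n}" using ex_bij_betw_finite_nat[OF fin(3)] card by (auto simp: atLeast0LessThan)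
  define f' where "f' = inv_into X f"
  define g' where "g' = inv_into Y g"
  have f': "bij_betw f' {..<n} X" and g': "bij_betw g' {..<n} Y"
    using f g by (auto simp: f'_def g'_def bij_betw_inv_into)
  have ff: "\<And>x. x \<in> X \<Longrightarrow> f' (f x) = x" "\<And>r. r < n \<Longrightarrow> f (f' r) = r"
    using f by (auto simp: f'_def bij_betw_inv_into_left bij_betw_inv_into_right)
  have gg: "\<And>x. x \<in> Y \<Longrightarrow> g' (g x) = x" "\<And>r. r < n \<Longrightarrow> g (g' r) = r"
    using g by (auto simp: g'_def bij_betw_inv_into_left bij_betw_inv_into_right)
  have mem: "\<And>r. r < n \<Longrightarrow> f' r \<in> X" "\<And>r. r < n \<Longrightarrow> g' r \<in> Y" "\<And>x. x \<in> X \<Longrightarrow> f x < n"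
    "\<And>x. x \<in> Y \<Longrightarrow> g x < n" "\<And>x. x \<in> Z \<Longrightarrow> h x < n"
    using f' g' f g h by (auto simp: bij_betw_def)
  have inj: "inj_on f X" "inj_on g Y" "inj_on h Z" "inj_on f' {..<n}" "inj_on g' {..<n}"
    using f g h f' g' by (auto simp: bij_betw_def)
  define M where "M r c = h (L (f' r) (g' c))" for r c
  have "latin_square n M"
  proof (rule latin_squareI)
    show "M r c < n" if "r < n" "c < n" for r c using that mem L(1) by (simp add: M_def)
    show "inj_on (M r) {..<n}" if r: "r < n" for r
    proof (rule inj_onI)
      fix c d assume "c \<in> {..<n}" "d \<in> {..<n}" "M r c = M r d"
      then show "c = d"
        using inj_onD[OF inj(3)] inj_onD[OF L(2)[OF mem(1)[OF r]]] inj_onD[OF inj(5)] mem L(1) r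
        by (simp add: M_def)
    qed
    show "inj_on (\<lambda>r. M r c) {..<n}" if c: "c < n" for c
    proof (rule inj_onI)
      fix r s assume "r \<in> {..<n}" "s \<in> {..<n}" "M r c = M s c"
      then show "r = s"
        using inj_onD[OF inj(3)] inj_onD[OF L(3)[OF mem(2)[OF c]]] inj_onD[OF inj(4)] mem L(1) c
        by (simp add: M_def)
    qed
  qed
  moreover have "\<exists>T. unextendable_pt {..<n} {..<n} M T \<and> card T + d = n" if d: "2 * d \<le> n" for d
  proof -
    obtain T where T: "unextendable_pt X Y L T" "card T + d = n" using T d by blast
    have TX: "x \<in> X \<and> y \<in> Y \<and> z \<in> Z \<and> z = L x y" if "(x, y, z) \<in> T" for x y z
    proof -
      have "x \<in> X \<and> y \<in> Y \<and> z = L x y"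
        using T(1) that unfolding unextendable_pt_def by blast
      then show ?thesis using L(1) by auto
    qed
    define k where "k = (\<lambda>(x, y, z). (f x, g y, h z))"
    have k: "inj_on k T"
      unfolding k_def using TX inj by (auto simp: inj_on_def)
    have "unextendable_pt {..<n} {..<n} M (k ` T)"
      unfolding unextendable_pt_def
    proof (intro conjI allI impI)
      fix r c v assume "(r, c, v) \<in> k ` T"
      then obtain x y z where "(x, y, z) \<in> T" "r = f x" "c = g y" "v = h z"
        by (auto simp: k_def)
      then show "r \<in> {..<n}" "c \<in> {..<n}" "v = M r c"
        using TX[of x y z] ff gg mem by (auto simp: M_def)
    next
      fix r c v r' c' v' assume t: "(r, c, v) \<in> k ` T" "(r', c', v') \<in> k ` T"
        and eq: "r = r' \<or> c = c' \<or> v = v'"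
      obtain x y z where t: "(x, y, z) \<in> T" "r = f x" "c = g y" "v = h z"
        using t(1) by (auto simp: k_def)
      obtain x' y' z' where t': "(x', y', z') \<in> T" "r' = f x'" "c' = g y'" "v' = h z'"
        using \<open>(r', c', v') \<in> k ` T\<close> by (auto simp: k_def)
      have "f x = f x' \<longleftrightarrow> x = x'" "g y = g y' \<longleftrightarrow> y = y'" "h z = h z' \<longleftrightarrow> z = z'"
        using TX[OF t(1)] TX[OF t'(1)] inj by (auto simp: inj_on_eq_iff)
      then have "x = x' \<or> y = y' \<or> z = z'" using eq unfolding t t' by blast
      moreover have "x = x' \<or> y = y' \<or> z = z' \<longrightarrow> x = x' \<and> y = y' \<and> z = z'"
        using T(1) t(1) t'(1) unfolding unextendable_pt_def by blast
      ultimately have "x = x'" "y = y'" "z = z'" by blast+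
      then show "r = r'" "c = c'" "v = v'" unfolding t t' by (simp_all only:)
    next
      fix r c assume "r \<in> {..<n}" "c \<in> {..<n}"
      then have r: "f' r \<in> X" "r = f (f' r)" and c: "g' c \<in> Y" "c = g (g' c)" using mem ff gg by auto
      then obtain x y z where t: "(x, y, z) \<in> T" "f' r = x \<or> g' c = y \<or> L (f' r) (g' c) = z"
        using T(1) unfolding unextendable_pt_def by blast
      then have "(f x, g y, h z) \<in> k ` T" by (force simp: k_def)
      moreover have "r = f x \<or> c = g y \<or> M r c = h z" using t(2) r(2) c(2) by (auto simp: M_def)
      ultimately show "\<exists>x' y' z'. (x', y', z') \<in> k ` T \<and> (r = x' \<or> c = y' \<or> M r c = z')" by blast
    qed
    then show ?thesis using T(2) card_image[OF k] by metis
  qed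
  ultimately show ?thesis unfolding omniversal_iff by blast
qed

section \<open>Orders without omniversal Latin squares\<close>

lemma unextendable_ptD:
  assumes "unextendable_pt X Y L T"
  shows "(x, y, z) \<in> T \<Longrightarrow> x \<in> X" "(x, y, z) \<in> T \<Longrightarrow> y \<in> Y" "(x, y, z) \<in> T \<Longrightarrow> L x y = z"
    and "(x, y, z) \<in> T \<Longrightarrow> (x, y', z') \<in> T \<Longrightarrow> y = y'"
    and "(x, y, z) \<in> T \<Longrightarrow> (x', y, z') \<in> T \<Longrightarrow> x = x'"
    and "(x, y, z) \<in> T \<Longrightarrow> (x', y', z) \<in> T \<Longrightarrow> x = x'"
    and "(x, y, z) \<in> T \<Longrightarrow> (x', y', z) \<in> T \<Longrightarrow> y = y'"
    and "x \<in> X \<Longrightarrow> y \<in> Y \<Longrightarrow> \<exists>x' y' z'. (x', y', z') \<in> T \<and> (x = x' \<or> y = y' \<or> L x y = z')"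
  using assms unfolding unextendable_pt_def by blast+

definition rows :: "('a \<times> 'b \<times> 'c) set \<Rightarrow> 'a set" where "rows T = fst ` T"
definition cols :: "('a \<times> 'b \<times> 'c) set \<Rightarrow> 'b set" where "cols T = (\<lambda>t. fst (snd t)) ` T"
definition syms :: "('a \<times> 'b \<times> 'c) set \<Rightarrow> 'c set" where "syms T = (\<lambda>t. snd (snd t)) ` T"

lemma in_rows: "r \<in> rows T \<longleftrightarrow> (\<exists>c s. (r, c, s) \<in> T)"
  and in_cols: "c \<in> cols T \<longleftrightarrow> (\<exists>r s. (r, c, s) \<in> T)"
  and in_syms: "s \<in> syms T \<longleftrightarrow> (\<exists>r c. (r, c, s) \<in> T)"
  by (force simp: rows_def cols_def syms_def)+

lemma unextendable_pt_inj:
  assumes "unextendable_pt X Y L T"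
  shows "inj_on fst T" "inj_on (\<lambda>t. fst (snd t)) T" "inj_on (\<lambda>t. snd (snd t)) T"
proof -
  note D = unextendable_ptD[OF assms]
  show "inj_on fst T" by (rule inj_onI) (metis D(3,4) prod.collapse)
  show "inj_on (\<lambda>t. fst (snd t)) T" by (rule inj_onI) (metis D(3,5) prod.collapse)
  show "inj_on (\<lambda>t. snd (snd t)) T" by (rule inj_onI) (metis D(6,7) prod.collapse)
qed

lemma unextendable_pt_card:
  assumes "unextendable_pt X Y L T"
  shows "card (rows T) = card T" "card (cols T) = card T" "card (syms T) = card T"
  using unextendable_pt_inj[OF assms] by (simp_all add: rows_def cols_def syms_def card_image)

lemma unextendable_pt_subset:
  assumes "unextendable_pt {..<n} {..<n} L T" "latin_square n L"
  shows "rows T \<subseteq> {..<n}" "cols T \<subseteq> {..<n}" "syms T \<subseteq> {..<n}"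
proof -
  note D = unextendable_ptD[OF assms(1)]
  show r: "rows T \<subseteq> {..<n}" and c: "cols T \<subseteq> {..<n}"
    using D(1,2) by (fastforce simp: rows_def cols_def)+
  show "syms T \<subseteq> {..<n}"
  proof
    fix s assume "s \<in> syms T"
    then obtain x y where "(x, y, s) \<in> T" by (auto simp: syms_def)
    then have "x < n" "y < n" "s = L x y" using D(1,2,3) by blast+
    then show "s \<in> {..<n}" using assms(2) by (simp add: latin_square_def)
  qed
qed

section \<open>Splitting at half length, and orders congruent to 2 modulo 4\<close>

text \<open>A transversal of half length splits the square into four subsquares.\<close>

lemma half_length_structure:
  assumes L: "latin_square (2 * l) L" and T: "unextendable_pt {..<2 * l} {..<2 * l} L T" and card: "card T = l"
    and r: "r < 2 * l" and c: "c < 2 * l"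
  shows "L r c \<in> syms T \<longleftrightarrow> (r \<in> rows T \<longleftrightarrow> c \<in> cols T)"
proof -
  let ?R = "rows T" and ?C = "cols T" and ?S = "syms T" and ?N = "{..<2 * l}"
  note sub = unextendable_pt_subset[OF T L]
  have [simp]: "card ?R = l" "card ?C = l" "card ?S = l" using unextendable_pt_card[OF T] card by auto
  have fin: "finite ?R" "finite ?C" "finite ?S" using sub finite_subset by blast+
  have co [simp]: "card (?N - ?R) = l" "card (?N - ?C) = l" "card (?N - ?S) = l"
    using sub fin by (simp_all add: card_Diff_subset)
  have lt: "L x y \<in> ?N" if "x < 2 * l" "y < 2 * l" for x y using L that by (simp add: latin_square_def)
  have D: "L x y \<in> ?S" if xy: "x \<in> ?N - ?R" "y \<in> ?N - ?C" for x y
  proof -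
    obtain x' y' z' where *: "(x', y', z') \<in> T" "x = x' \<or> y = y' \<or> L x y = z'"
      using unextendable_ptD(8)[OF T] xy by blast
    then have "x' \<in> ?R" "y' \<in> ?C" "z' \<in> ?S"
      by (force simp: rows_def cols_def syms_def)+
    then show ?thesis using * xy by auto
  qed
  have rowD: "L x ` (?N - ?C) = ?S" if "x \<in> ?N - ?R" for x
    using D that fin(3) inj_on_subset[OF latin_square_inj(1)[OF L]]
    by (intro card_subset_eq) (auto simp: card_image)
  have colD: "(\<lambda>x. L x y) ` (?N - ?R) = ?S" if "y \<in> ?N - ?C" for y
    using D that fin(3) inj_on_subset[OF latin_square_inj(2)[OF L]]
    by (intro card_subset_eq) (auto simp: card_image)
  have CC: "L x y \<notin> ?S" if x: "x \<in> ?N - ?R" and y: "y \<in> ?C" for x y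
  proof
    assume "L x y \<in> ?S"
    then obtain y' where "y' \<in> ?N - ?C" "L x y = L x y'" using rowD[OF x] by (metis imageE)
    then show False using inj_onD[OF latin_square_inj(1)[OF L]] x y sub by blast
  qed
  have BB: "L x y \<notin> ?S" if x: "x \<in> ?R" and y: "y \<in> ?N - ?C" for x y
  proof
    assume "L x y \<in> ?S"
    then obtain x' where "x' \<in> ?N - ?R" "L x y = L x' y" using colD[OF y] by (metis imageE)
    then show False using inj_onD[OF latin_square_inj(2)[OF L]] x y sub by blast
  qed
  have rowB: "L x ` (?N - ?C) = ?N - ?S" if "x \<in> ?R" for x
    using BB that sub lt inj_on_subset[OF latin_square_inj(1)[OF L]]
    by (intro card_subset_eq) (auto simp: card_image)
  have AA: "L x y \<in> ?S" if x: "x \<in> ?R" and y: "y \<in> ?C" for x y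
  proof (rule ccontr)
    assume "L x y \<notin> ?S"
    then have "L x y \<in> ?N - ?S" using lt sub x y by blast
    then obtain y' where "y' \<in> ?N - ?C" "L x y = L x y'" using rowB[OF x] by (metis imageE)
    then show False using inj_onD[OF latin_square_inj(1)[OF L]] x y sub by blast
  qed
  show ?thesis using AA BB CC D r c by blast
qed

text \<open>The splitting given by \<open>T\<close> makes the weight \<open>w\<close> of each triple
  of \<open>V\<close> equal to 1 or 3. There are \<open>2 * l\<close> triples, so the total weight
  is even; but \<open>V\<close> meets every row, column and symbol once, so the total is
  \<open>3 * l\<close>, which is odd.\<close>

lemma no_omniversal_2_mod_4:
  assumes "n mod 4 = 2"
  shows "\<not> omniversal n L"
proof
  assume om: "omniversal n L"
  obtain l where n: "n = 2 * l" and l: "odd l"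
  proof
    show "n = 2 * (n div 2)" "odd (n div 2)" using assms by presburger+
  qed
  obtain T where T: "unextendable_pt {..<n} {..<n} L T" "card T = l"
    using om n unfolding omniversal_iff by (metis add_right_cancel le_refl mult_2)
  obtain V where V: "unextendable_pt {..<n} {..<n} L V" "card V = n"
    using om unfolding omniversal_iff by (metis add.right_neutral mult_0_right zero_le)
  have L: "latin_square n L" using om by (simp add: omniversal_iff)
  note sub = unextendable_pt_subset[OF T(1) L] and subV = unextendable_pt_subset[OF V(1) L]
  note cV = unextendable_pt_card[OF V(1)] and cT = unextendable_pt_card[OF T(1)] and inj = unextendable_pt_inj[OF V(1)]
  have full: "rows V = {..<n}" "cols V = {..<n}" "syms V = {..<n}"
    using subV cV V(2) by (simp_all add: card_subset_eq)
  have fin: "finite V" using V(2) n l by (metis card.infinite mult_eq_0_iff odd_pos less_irrefl zero_neq_numeral)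
  have count: "(\<Sum>t\<in>V. of_bool (f t \<in> A)) = card A" if "inj_on f V" "f ` V = {..<n}" "A \<subseteq> {..<n}" for f A
  proof -
    have "(\<Sum>t\<in>V. of_bool (f t \<in> A)) = (\<Sum>i<n. of_bool (i \<in> A) :: nat)"
      using sum.reindex[OF that(1), of "\<lambda>i. of_bool (i \<in> A) :: nat"] that(2) by simp
    also have "\<dots> = card A"
      using that(3) by (simp add: of_bool_def sum.If_cases Int_absorb1)
    finally show ?thesis .
  qed
  define w where "w = (\<lambda>(r, c, s). of_bool (r \<in> rows T) + of_bool (c \<in> cols T) + of_bool (s \<in> syms T) :: nat)"
  have "sum w V = (\<Sum>t\<in>V. of_bool (fst t \<in> rows T)) + (\<Sum>t\<in>V. of_bool (fst (snd t) \<in> cols T))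
      + (\<Sum>t\<in>V. of_bool (snd (snd t) \<in> syms T))"
    by (simp add: w_def case_prod_unfold sum.distrib)
  also have "\<dots> = 3 * l"
    using count[OF inj(1) _ sub(1)] count[OF inj(2) _ sub(2)] count[OF inj(3) _ sub(3)] full cT T(2)
    by (simp add: rows_def cols_def syms_def)
  finally have "odd (sum w V)" using l by simp
  moreover have "odd (w t)" if "t \<in> V" for t
  proof -
    obtain r c s where t: "t = (r, c, s)" by (cases t)
    have "r < n" "c < n" "L r c = s" using unextendable_ptD(1-3)[OF V(1)] that t by blast+
    then have "s \<in> syms T \<longleftrightarrow> (r \<in> rows T \<longleftrightarrow> c \<in> cols T)"
      using half_length_structure[of l L T r c] L T n by auto
    then show ?thesis unfolding t w_def by auto
  qed
  then have "{t \<in> V. odd (w t)} = V" by blast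
  ultimately show False using even_sum_iff[OF fin, of w] V(2) n by simp
qed

section \<open>Orders 3 and 4\<close>

lemma card_lessThan_diff_obtain:
  assumes "A \<subseteq> {..<n}" "card A < n"
  obtains a where "a < n" "a \<notin> A"
proof -
  have "\<not> {..<n} \<subseteq> A"
    using assms by (metis card_lessThan card_mono finite_lessThan finite_subset linorder_not_less)
  then show thesis using that by auto
qed

text \<open>Suppose that the free cell carries \<open>s1\<close>. Rows \<open>r0\<close> and
  \<open>r1\<close> then have this symbol in columns \<open>c0\<close> and \<open>c1\<close>, so row
  \<open>r2\<close> must have it in column \<open>c2\<close>, where it has \<open>s2\<close>. The
  case of \<open>s2\<close> is symmetric.\<close>

lemma no_omniversal_3: "\<not> omniversal 3 L"
proof
  assume om: "omniversal 3 L"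
  then have L: "latin_square 3 L" by (simp add: omniversal_iff)
  obtain T where T: "unextendable_pt {..<3} {..<3} L T" "card T = 2"
    using om unfolding omniversal_iff by (auto dest!: spec[of _ 1])
  note D = unextendable_ptD[OF T(1)]
  obtain r1 c1 s1 r2 c2 s2 where T': "T = {(r1, c1, s1), (r2, c2, s2)}"
    using T(2) by (auto simp: card_2_iff)
  have t: "(r1, c1, s1) \<in> T" "(r2, c2, s2) \<in> T" using T' by auto
  have lt: "r1 < 3" "c1 < 3" "L r1 c1 = s1" "r2 < 3" "c2 < 3" "L r2 c2 = s2"
    using D(1,2,3)[OF t(1)] D(1,2,3)[OF t(2)] by auto
  have "card (rows T) = 2" "card (cols T) = 2" "card (syms T) = 2"
    using unextendable_pt_card[OF T(1)] T(2) by auto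
  then have ne: "r1 \<noteq> r2" "c1 \<noteq> c2" "s1 \<noteq> s2" by (auto simp: T' rows_def cols_def syms_def)
  obtain r0 where r0: "r0 < 3" "r0 \<noteq> r1" "r0 \<noteq> r2"
    using card_lessThan_diff_obtain[of "{r1, r2}" 3] lt ne by auto
  obtain c0 where c0: "c0 < 3" "c0 \<noteq> c1" "c0 \<noteq> c2"
    using card_lessThan_diff_obtain[of "{c1, c2}" 3] lt ne by auto
  have only: "c = c0 \<or> c = c1 \<or> c = c2" if "c < 3" for c
    using that c0 ne lt by linarith
  note row = inj_onD[OF latin_square_inj(1)[OF L]] and col = inj_onD[OF latin_square_inj(2)[OF L]]
  have "L r0 c0 = s1 \<or> L r0 c0 = s2" using D(8)[of r0 c0] r0 c0 T' by auto
  then show False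
  proof
    assume eq: "L r0 c0 = s1"
    have "s1 < 3" using L lt by (auto simp: latin_square_def)
    then obtain c where c: "c < 3" "L r2 c = s1" using L lt(4) unfolding latin_square_def by blast
    from only[OF c(1)] show False
      using c col[of c0 r0 r2] col[of c1 r1 r2] eq lt ne r0 c0 by auto
  next
    assume eq: "L r0 c0 = s2"
    have "s2 < 3" using L lt by (auto simp: latin_square_def)
    then obtain c where c: "c < 3" "L r1 c = s2" using L lt(1) unfolding latin_square_def by blast
    from only[OF c(1)] show False
      using c col[of c0 r0 r1] col[of c2 r2 r1] eq lt ne r0 c0 by auto
  qed
qed

text \<open>The two tables are affine over the field with four elements: with 2 as a generator w and
  3 as w + 1, the first is w^2 x + w y, and the second is its transpose. Idempotence leaves two
  candidates for each entry off the diagonal, and the choice of \<open>A 0 1\<close> forces all the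
  others.\<close>

lemma idempotent_order_4:
  fixes A :: "nat \<Rightarrow> nat \<Rightarrow> nat"
  assumes lt: "\<And>x y. x < 4 \<Longrightarrow> y < 4 \<Longrightarrow> A x y < 4" and id: "\<And>x. x < 4 \<Longrightarrow> A x x = x"
    and row: "\<And>x y z. x < 4 \<Longrightarrow> y < 4 \<Longrightarrow> z < 4 \<Longrightarrow> A x y = A x z \<Longrightarrow> y = z"
    and col: "\<And>x y z. x < 4 \<Longrightarrow> y < 4 \<Longrightarrow> z < 4 \<Longrightarrow> A y x = A z x \<Longrightarrow> y = z"
  shows "\<exists>M \<in> {[[0, 2, 3, 1], [3, 1, 0, 2], [1, 3, 2, 0], [2, 0, 1, 3]],
      [[0, 3, 1, 2], [2, 1, 3, 0], [3, 0, 2, 1], [1, 2, 0, 3]]}. \<forall>x<4. \<forall>y<4. A x y = M ! x ! y"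
proof -
  have all: "(\<forall>x<4. P x) \<longleftrightarrow> P 0 \<and> P 1 \<and> P 2 \<and> P 3" for P :: "nat \<Rightarrow> bool"
    by (auto simp: less_Suc_eq numeral_eq_Suc)
  have v: "A x y \<in> {0, 1, 2, 3} - {x, y}" if "x < 4" "y < 4" "x \<noteq> y" for x y
    using lt[of x y] id[of x] id[of y] row[of x y x] col[of y x y] that
    by (auto simp: less_Suc_eq numeral_eq_Suc)
  have ne: "A x y \<noteq> A x z" "A y x \<noteq> A z x" if "x < 4" "y < 4" "z < 4" "y \<noteq> z" for x y z
    using row col that by blast+
  have "A 0 1 = 2 \<or> A 0 1 = 3" using v[of 0 1] by auto
  then show ?thesis
  proof
    assume 1: "A 0 1 = 2"
    have 2: "A 0 3 = 1" using v[of 0 3] ne(1)[of 0 1 3] 1 by auto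
    have 3: "A 0 2 = 3" using v[of 0 2] ne(1)[of 0 2 3] 2 by auto
    have 4: "A 3 1 = 0" using v[of 3 1] ne(2)[of 1 0 3] 1 by auto
    have 5: "A 2 1 = 3" using v[of 2 1] ne(2)[of 1 2 3] 4 by auto
    have 6: "A 1 2 = 0" using v[of 1 2] ne(2)[of 2 0 1] 3 by auto
    have 7: "A 3 2 = 1" using v[of 3 2] ne(2)[of 2 1 3] 6 by auto
    have 8: "A 3 0 = 2" using v[of 3 0] ne(1)[of 3 0 2] 7 by auto
    have 9: "A 1 0 = 3" using v[of 1 0] ne(2)[of 0 1 3] 8 by auto
    have 10: "A 2 0 = 1" using v[of 2 0] ne(2)[of 0 1 2] 9 by auto
    have 11: "A 2 3 = 0" using v[of 2 3] ne(1)[of 2 0 3] 10 by auto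
    have 12: "A 1 3 = 2" using v[of 1 3] ne(2)[of 3 1 2] 11 by auto
    show ?thesis
      using 1 2 3 4 5 6 7 8 9 10 11 12 id unfolding all by (intro bexI[of _ "[[0, 2, 3, 1], [3, 1, 0, 2], [1, 3, 2, 0], [2, 0, 1, 3]]"]) simp_all
  next
    assume 1: "A 0 1 = 3"
    have 2: "A 0 2 = 1" using v[of 0 2] ne(1)[of 0 1 2] 1 by auto
    have 3: "A 0 3 = 2" using v[of 0 3] ne(1)[of 0 2 3] 2 by auto
    have 4: "A 2 1 = 0" using v[of 2 1] ne(2)[of 1 0 2] 1 by auto
    have 5: "A 3 1 = 2" using v[of 3 1] ne(2)[of 1 2 3] 4 by auto
    have 6: "A 1 3 = 0" using v[of 1 3] ne(2)[of 3 0 1] 3 by auto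
    have 7: "A 2 3 = 1" using v[of 2 3] ne(2)[of 3 1 2] 6 by auto
    have 8: "A 2 0 = 3" using v[of 2 0] ne(1)[of 2 0 3] 7 by auto
    have 9: "A 1 0 = 2" using v[of 1 0] ne(2)[of 0 1 2] 8 by auto
    have 10: "A 3 0 = 1" using v[of 3 0] ne(2)[of 0 1 3] 9 by auto
    have 11: "A 3 2 = 0" using v[of 3 2] ne(1)[of 3 0 2] 10 by auto
    have 12: "A 1 2 = 3" using v[of 1 2] ne(2)[of 2 1 3] 11 by auto
    show ?thesis
      using 1 2 3 4 5 6 7 8 9 10 11 12 id unfolding all by (intro bexI[of _ "[[0, 3, 1, 2], [2, 1, 3, 0], [3, 0, 2, 1], [1, 2, 0, 3]]"]) simp_all
  qed
qed

text \<open>The reason behind the check: both tables are affine over the field with four elements,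
  whose elements sum to 0. So the symbols in four cells from different rows and columns sum to 0,
  and if three of them are distinct, the fourth is the missing one.\<close>

lemma tables_order_4:
  "\<forall>M \<in> {[[0, 2, 3, 1], [3, 1, 0, 2], [1, 3, 2, 0], [2, 0, 1, 3]],
      [[0, 3, 1, 2], [2, 1, 3, 0], [3, 0, 2, 1], [1, 2, 0, 3::nat]]}.
   \<forall>g0 \<in> set [0..<4]. \<forall>g1 \<in> set [0..<4]. \<forall>g2 \<in> set [0..<4]. \<forall>g3 \<in> set [0..<4].
     distinct [g0, g1, g2, g3] \<longrightarrow> length (remdups [M ! 0 ! g0, M ! 1 ! g1, M ! 2 ! g2, M ! 3 ! g3]) \<noteq> 3"
  by code_simp

text \<open>The transversal \<open>V\<close> renames columns through \<open>cf\<close> and symbols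
  through \<open>sf\<close>, which turns the square into the idempotent square \<open>A\<close>. A
  maximal \<open>T\<close> of length 3 together with its free cell would be a permutation showing
  exactly three symbols.\<close>

lemma no_omniversal_4: "\<not> omniversal 4 L"
proof
  assume om: "omniversal 4 L"
  then have L: "latin_square 4 L" by (simp add: omniversal_iff)
  obtain V where V: "unextendable_pt {..<4} {..<4} L V" "card V = 4"
    using om unfolding omniversal_iff by (auto dest!: spec[of _ 0])
  obtain T where T: "unextendable_pt {..<4} {..<4} L T" "card T = 3"
    using om unfolding omniversal_iff by (auto dest!: spec[of _ 1])
  note D = unextendable_ptD[OF V(1)] and E = unextendable_ptD[OF T(1)]
  note row = inj_onD[OF latin_square_inj(1)[OF L]] and col = inj_onD[OF latin_square_inj(2)[OF L]]
  have full: "rows V = {..<4}" "cols V = {..<4}" "syms V = {..<4}"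
    using unextendable_pt_subset[OF V(1) L] unextendable_pt_card[OF V(1)] V(2) by (simp_all add: card_subset_eq)
  have "\<exists>c s. (r, c, s) \<in> V" if "r < 4" for r
    using full(1) that in_rows[of r V] by auto
  then obtain cf sf where V': "\<And>r. r < 4 \<Longrightarrow> (r, cf r, sf r) \<in> V" by metis
  have lt: "cf r < 4" "L r (cf r) = sf r" if "r < 4" for r using D(2,3)[OF V'[OF that]] by auto
  have cinj: "r = r'" if "r < 4" "r' < 4" "cf r = cf r'" for r r'
    using D(5) V' that by metis
  have sinj: "r = r'" if "r < 4" "r' < 4" "sf r = sf r'" for r r'
    using D(6) V' that by metis
  have csur: "\<exists>k<4. cf k = c" if "c < 4" for c
  proof -
    obtain r s where rs: "(r, c, s) \<in> V" using full(2) \<open>c < 4\<close> in_cols[of c V] by auto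
    then have "r < 4" using D(1) by auto
    then show ?thesis using D(4)[OF rs V'] by auto
  qed
  have ssur: "\<exists>k<4. sf k = s" if "s < 4" for s
  proof -
    obtain r c where rs: "(r, c, s) \<in> V" using full(3) \<open>s < 4\<close> in_syms[of s V] by auto
    then have r: "r < 4" using D(1) by auto
    then have "c = cf r" using D(4)[OF rs V'] by auto
    then show ?thesis using D(3)[OF rs] lt(2)[OF r] r by auto
  qed
  have "\<exists>a<4. sf a = L x (cf y)" if "x < 4" "y < 4" for x y
    using ssur L lt(1)[OF that(2)] that(1) by (simp add: latin_square_def)
  then obtain A where A: "\<And>x y. x < 4 \<Longrightarrow> y < 4 \<Longrightarrow> A x y < 4 \<and> sf (A x y) = L x (cf y)" by metis
  obtain M where M: "M \<in> {[[0, 2, 3, 1], [3, 1, 0, 2], [1, 3, 2, 0], [2, 0, 1, 3]],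
      [[0, 3, 1, 2], [2, 1, 3, 0], [3, 0, 2, 1], [1, 2, 0, 3]]}"
    and AM: "\<And>x y. x < 4 \<Longrightarrow> y < 4 \<Longrightarrow> A x y = M ! x ! y"
  proof -
    have "A x x = x" if "x < 4" for x using A[OF that that] lt that sinj by metis
    moreover have "A x y < 4" if "x < 4" "y < 4" for x y using A that by blast
    moreover have "y = z" if "x < 4" "y < 4" "z < 4" "A x y = A x z" for x y z
      using A[of x y] A[of x z] that lt(1) row[of x "cf y" "cf z"] cinj[of y z] by auto
    moreover have "y = z" if "x < 4" "y < 4" "z < 4" "A y x = A z x" for x y z
      using A[of y x] A[of z x] that lt(1)[of x] col[of "cf x" y z] by auto
    ultimately have "\<exists>M \<in> {[[0, 2, 3, 1], [3, 1, 0, 2], [1, 3, 2, 0], [2, 0, 1, 3]],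
        [[0, 3, 1, 2], [2, 1, 3, 0], [3, 0, 2, 1], [1, 2, 0, 3]]}. \<forall>x<4. \<forall>y<4. A x y = M ! x ! y"
      by (intro idempotent_order_4)
    then show thesis using that by blast
  qed
  have cT: "card (rows T) = 3" "card (cols T) = 3" "card (syms T) = 3"
    using unextendable_pt_card[OF T(1)] T(2) by auto
  note subT = unextendable_pt_subset[OF T(1) L]
  obtain r0 where r0: "r0 < 4" "r0 \<notin> rows T"
    using card_lessThan_diff_obtain[OF subT(1)] cT by auto
  obtain c0 where c0: "c0 < 4" "c0 \<notin> cols T"
    using card_lessThan_diff_obtain[OF subT(2)] cT by auto
  have rT: "rows T = {..<4} - {r0}"
    using subT(1) r0 cT by (intro card_subset_eq) auto
  \<comment> \<open>This prepares \<open>g\<close>, the permutation of \<open>T\<close> in renamed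
    columns, completed by the free cell in the one row that \<open>T\<close> omits.\<close>
  have "\<exists>k<4. if r = r0 then cf k = c0 else \<exists>s. (r, cf k, s) \<in> T" if r: "r < 4" for r
  proof (cases "r = r0")
    case False
    then have "r \<in> rows T" using rT r by simp
    then obtain c s where cs: "(r, c, s) \<in> T" using in_rows by metis
    then show ?thesis using False csur[OF E(2)[OF cs, simplified]] by auto
  qed (use csur c0 in auto)
  then obtain g where g: "\<And>r. r < 4 \<Longrightarrow> g r < 4 \<and> (if r = r0 then cf (g r) = c0 else \<exists>s. (r, cf (g r), s) \<in> T)"
    by metis
  define a where "a r = A r (g r)" for r
  have gT: "(r, cf (g r), sf (a r)) \<in> T" if "r < 4" "r \<noteq> r0" for r
    using g[OF that(1)] that E(3) A[of r "g r"] by (auto simp: a_def)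
  have g0: "cf (g r0) = c0" using g[OF r0(1)] by simp
  have ginj: "r = r'" if "r < 4" "r' < 4" "g r = g r'" for r r'
  proof (cases "r = r0 \<or> r' = r0")
    case True
    then show ?thesis using that gT g0 c0(2) in_cols by metis
  next
    case False
    then show ?thesis using E(5)[of r "cf (g r)" _ r'] gT that by metis
  qed
  have ainj: "r = r'" if "r < 4" "r' < 4" "r \<noteq> r0" "r' \<noteq> r0" "a r = a r'" for r r'
    using E(6) gT that by metis
  obtain r1 where r1: "r1 < 4" "r1 \<noteq> r0" "a r1 = a r0"
  proof -
    obtain x y z where t: "(x, y, z) \<in> T" "r0 = x \<or> c0 = y \<or> L r0 c0 = z"
      using E(8)[of r0 c0] r0(1) c0(1) by auto
    have "x \<in> rows T" "y \<in> cols T" using t(1) in_rows[of x T] in_cols[of y T] by auto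
    then have x: "x \<noteq> r0" "c0 \<noteq> y" "x < 4"
      using r0(2) c0(2) E(1)[OF t(1)] by auto
    have "(x, cf (g x), sf (a x)) \<in> T" by (rule gT) (use x in auto)
    then have z1: "sf (a x) = z" using E(3)[OF t(1)] E(4)[OF t(1)] E(3) by metis
    have z2: "z = sf (a r0)" using t(2) x A[OF r0(1)] g[OF r0(1)] g0 by (simp add: a_def)
    have "a x < 4" "a r0 < 4" using A g x(3) r0(1) unfolding a_def by blast+
    from sinj[OF this trans[OF z1 z2]] show thesis by (rule that[OF x(3) x(1)])
  qed
  have "distinct [g 0, g 1, g 2, g 3]"
    using ginj[of 0 1] ginj[of 0 2] ginj[of 0 3] ginj[of 1 2] ginj[of 1 3] ginj[of 2 3] by auto
  then have "length (remdups [a 0, a 1, a 2, a 3]) \<noteq> 3"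
    using tables_order_4[rule_format, OF M, of "g 0" "g 1" "g 2" "g 3"] g[of 0] g[of 1] g[of 2] g[of 3]
    by (simp add: a_def AM)
  moreover have "card ({..<4} - {r0}) = 3" using r0 by simp
  moreover have "set [a 0, a 1, a 2, a 3] = a ` ({..<4} - {r0})"
  proof -
    have "set [a 0, a 1, a 2, a 3] = a ` {..<4}" by (simp add: lessThan_nat_numeral lessThan_Suc insert_commute)
    also have "\<dots> = a ` insert r0 ({..<4} - {r0})"
      by (rule arg_cong[where f = "image a"]) (use r0(1) in auto)
    also have "\<dots> = a ` ({..<4} - {r0})"
    proof -
      have "a r0 \<in> a ` ({..<4} - {r0})" using r1 by (metis Diff_iff imageI lessThan_iff singletonD)
      then show ?thesis unfolding image_insert by (rule insert_absorb)
    qed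
    finally show ?thesis .
  qed
  moreover have "inj_on a ({..<4} - {r0})" using ainj by (auto intro!: inj_onI)
  ultimately show False
    by (metis card_image length_remdups_card_conv)
qed

section \<open>Odd orders\<close>

lemma unextendable_ptI:
  assumes "\<And>x y z. (x, y, z) \<in> T \<Longrightarrow> x \<in> X \<and> y \<in> Y \<and> L x y = z"
    and "\<And>x y z y' z'. (x, y, z) \<in> T \<Longrightarrow> (x, y', z') \<in> T \<Longrightarrow> y = y'"
    and "\<And>x y z x' z'. (x, y, z) \<in> T \<Longrightarrow> (x', y, z') \<in> T \<Longrightarrow> x = x'"
    and "\<And>x y z x' y'. (x, y, z) \<in> T \<Longrightarrow> (x', y', z) \<in> T \<Longrightarrow> x = x'"
    and "\<And>x y. x \<in> X \<Longrightarrow> y \<in> Y \<Longrightarrow> x \<in> rows T \<or> y \<in> cols T \<or> L x y \<in> syms T"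
  shows "unextendable_pt X Y L T"
  unfolding unextendable_pt_def
proof (intro conjI allI impI)
  fix x y assume "x \<in> X" "y \<in> Y"
  then show "\<exists>x' y' z'. (x', y', z') \<in> T \<and> (x = x' \<or> y = y' \<or> L x y = z')"
    using assms(5)[of x y] unfolding in_rows in_cols in_syms by blast
next
  fix x y z assume "(x, y, z) \<in> T"
  then show "x \<in> X" "y \<in> Y" "z = L x y" using assms(1) by blast+
next
  fix x y z x' y' z'
  assume t: "(x, y, z) \<in> T" "(x', y', z') \<in> T" and "x = x' \<or> y = y' \<or> z = z'"
  then show x: "x = x'" using assms(3)[of x y z x' z'] assms(4)[of x y z x' y'] by auto
  then show y: "y = y'" using assms(2) t by blast
  show "z = z'" using assms(1)[OF t(1)] assms(1)[OF t(2)] x y by simp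
qed

text \<open>The residue of \<open>s / 2\<close> modulo an odd number \<open>m\<close>, for \<open>s < 2 * m\<close>.\<close>

definition half :: "nat \<Rightarrow> nat \<Rightarrow> nat" where
  "half m s = (if even s then s div 2 else if s < m then (s + m) div 2 else (s - m) div 2)"

lemma half_cases:
  assumes "odd m" "s < 2 * m"
  shows "half m s < m" "2 * half m s = s \<or> 2 * half m s = s + m \<or> 2 * half m s + m = s"
  using assms unfolding half_def by (auto elim!: oddE)

lemma half_less: "odd m \<Longrightarrow> s < 2 * m \<Longrightarrow> half m s < m"
  by (rule half_cases)

lemma half_add: "odd m \<Longrightarrow> s < m \<Longrightarrow> half m (s + m) = half m s"
  by (auto simp: half_def)

lemma half_double: "half m (2 * i) = i" "half m (i + i) = i"
  by (simp_all add: half_def flip: mult_2)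

lemma half_eq_iff:
  assumes "odd m" "s < 2 * m" "t < 2 * m"
  shows "half m s = half m t \<longleftrightarrow> s = t \<or> s = t + m \<or> t = s + m"
proof
  assume "half m s = half m t"
  then show "s = t \<or> s = t + m \<or> t = s + m"
    using half_cases(2)[OF assms(1,2)] half_cases(2)[OF assms(1,3)] assms(2,3) by linarith
next
  assume "s = t \<or> s = t + m \<or> t = s + m"
  then show "half m s = half m t"
    using half_add[of m s] half_add[of m t] assms by auto
qed

lemma half_eq_0_iff:
  assumes "odd m" "s < 2 * m"
  shows "half m s = 0 \<longleftrightarrow> s = 0 \<or> s = m"
  using half_eq_iff[OF assms(1,2), of 0] half_double(1)[of m 0] assms by auto

section \<open>Orders congruent to 3 modulo 4\<close>

text \<open>With \<open>q = 2 * g + 1\<close>, this is a prolongation of the block square built from \<open>(i + j) / 2\<close> modulo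
  \<open>q\<close>: the new row and column are \<open>Inl q\<close>, the new symbol is \<open>Inr q\<close>.\<close>

definition square_4g3 :: "nat \<Rightarrow> nat + nat \<Rightarrow> nat + nat \<Rightarrow> nat + nat" where
  "square_4g3 g x y = (let q = Suc (2 * g) in case (x, y) of
     (Inl i, Inl j) \<Rightarrow> if i = j then Inr i else if i = q then Inl j else if j = q then Inl i
       else Inl (half q (i + j))
   | (Inl i, Inr j) \<Rightarrow> Inr (if i = q then j else if i = j then q else half q (i + j))
   | (Inr i, Inl j) \<Rightarrow> Inr (if j = q then i else if i = j then q else half q (i + j))
   | (Inr i, Inr j) \<Rightarrow> Inl (if half q (i + j) = 2 * g then 0 else Suc (half q (i + j))))"

lemma square_4g3_simps:
  "square_4g3 g (Inl i) (Inl j) = (if i = j then Inr i else if i = Suc (2 * g) then Inl j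
     else if j = Suc (2 * g) then Inl i else Inl (half (Suc (2 * g)) (i + j)))"
  "square_4g3 g (Inl i) (Inr j) = Inr (if i = Suc (2 * g) then j else if i = j then Suc (2 * g)
     else half (Suc (2 * g)) (i + j))"
  "square_4g3 g (Inr i) (Inl j) = Inr (if j = Suc (2 * g) then i else if i = j then Suc (2 * g)
     else half (Suc (2 * g)) (i + j))"
  "square_4g3 g (Inr i) (Inr j) = Inl (if half (Suc (2 * g)) (i + j) = 2 * g then 0
     else Suc (half (Suc (2 * g)) (i + j)))"
  by (simp_all add: square_4g3_def Let_def)

lemma square_4g3_commute: "square_4g3 g x y = square_4g3 g y x"
  by (cases x; cases y; auto simp: square_4g3_simps add.commute)

text \<open>In a row \<open>Inl i\<close> with \<open>i \<le> 2 * g\<close>, the symbol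
  \<open>Inl i\<close> leaves the diagonal cell of the first block for the new column. Its place
  goes to \<open>Inr i\<close>, which the new symbol displaces from the diagonal cell of the second
  block. Columns follow by symmetry.\<close>

lemma square_4g3_latin:
  fixes g
  defines "X \<equiv> {..Suc (2 * g)} <+> {..2 * g}" and "Z \<equiv> {..2 * g} <+> {..Suc (2 * g)}"
  shows "x \<in> X \<Longrightarrow> y \<in> X \<Longrightarrow> square_4g3 g x y \<in> Z"
    and "x \<in> X \<Longrightarrow> inj_on (square_4g3 g x) X"
    and "y \<in> X \<Longrightarrow> inj_on (\<lambda>x. square_4g3 g x y) X"
proof -
  let ?h = "half (Suc (2 * g))"
  have odd: "odd (Suc (2 * g))" by simp
  have less: "?h (i + j) \<le> 2 * g" if "i \<le> 2 * g" "j \<le> 2 * g" for i j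
    using half_less[OF odd, of "i + j"] that by simp
  then have ne: "?h (i + j) \<noteq> Suc (2 * g)" "Suc (2 * g) \<noteq> ?h (i + j)" if "i \<le> 2 * g" "j \<le> 2 * g" for i j
    using that by (metis Suc_n_not_le_n)+
  have cancel: "?h (i + j) = ?h (i + j') \<longleftrightarrow> j = j'" if "i \<le> 2 * g" "j \<le> 2 * g" "j' \<le> 2 * g" for i j j'
    using half_eq_iff[OF odd, of "i + j" "i + j'"] that by auto
  have self: "?h (i + j) = i \<longleftrightarrow> i = j" if "i \<le> 2 * g" "j \<le> 2 * g" for i j
    using cancel[of i j i] that half_double(2)[of "Suc (2 * g)" i] by auto
  have self': "i = ?h (i + j) \<longleftrightarrow> i = j" if "i \<le> 2 * g" "j \<le> 2 * g" for i j
    using self[OF that] by auto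
  have top: "?h (i + j) = 2 * g \<Longrightarrow> ?h (i + j') = 2 * g \<Longrightarrow> j = j'"
    if "i \<le> 2 * g" "j \<le> 2 * g" "j' \<le> 2 * g" for i j j'
    using cancel[OF that] by simp
  show "square_4g3 g x y \<in> Z" if "x \<in> X" "y \<in> X" for x y
    using that unfolding X_def Z_def
    by (cases x; cases y; auto simp: square_4g3_simps less le_Suc_eq le_neq_implies_less Suc_le_eq)
  show row: "inj_on (square_4g3 g x) X" if "x \<in> X" for x
  proof (rule inj_onI)
    have X: thesis if "u \<in> X" "u = Inl (Suc (2 * g)) \<Longrightarrow> thesis" "\<And>i. i \<le> 2 * g \<Longrightarrow> u = Inl i \<Longrightarrow> thesis"
        "\<And>i. i \<le> 2 * g \<Longrightarrow> u = Inr i \<Longrightarrow> thesis" for u thesis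
      using that unfolding X_def by (auto simp: le_Suc_eq)
    fix y y' assume y: "y \<in> X" and y': "y' \<in> X" and eq: "square_4g3 g x y = square_4g3 g x y'"
    show "y = y'"
    proof (rule X[OF that])
      assume "x = Inl (Suc (2 * g))"
      with eq show ?thesis
        by - (rule X[OF y]; rule X[OF y']; simp add: square_4g3_simps split: if_splits)
    next
      fix i assume i: "i \<le> 2 * g" "x = Inl i"
      have i': "i \<noteq> Suc (2 * g)" using i by simp
      show ?thesis
        by (rule X[OF y]; rule X[OF y']; cases "y = Inl i \<or> y = Inr i"; cases "y' = Inl i \<or> y' = Inr i";
            insert eq i i'; simp add: square_4g3_simps cancel self self' ne)
    next
      fix i assume i: "i \<le> 2 * g" "x = Inr i"
      have i': "i \<noteq> Suc (2 * g)" using i by simp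
      show ?thesis
        by (rule X[OF y]; rule X[OF y']; cases "y = Inl i"; cases "y' = Inl i";
            insert eq i i' top[of i]; simp add: square_4g3_simps cancel self self' ne split: if_splits)
    qed
  qed
  show "inj_on (\<lambda>x. square_4g3 g x y) X" if "y \<in> X" for y
  proof -
    have "(\<lambda>x. square_4g3 g x y) = square_4g3 g y" by (rule ext) (rule square_4g3_commute)
    then show ?thesis using row[OF that] by simp
  qed
qed


text \<open>The successor modulo \<open>2 * g + 1\<close>, and half the sum of a residue and its successor.\<close>

definition next_mod :: "nat \<Rightarrow> nat \<Rightarrow> nat" where
  "next_mod g i = (if i = 2 * g then 0 else Suc i)"

definition mid_next :: "nat \<Rightarrow> nat \<Rightarrow> nat" where
  "mid_next g i = (if i < g then i + g + 1 else i - g)"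

lemma next_mod_eq_iff: "i \<le> 2 * g \<Longrightarrow> j \<le> 2 * g \<Longrightarrow> next_mod g i = next_mod g j \<longleftrightarrow> i = j"
  by (auto simp: next_mod_def)

lemma next_mod_eq_Suc_iff: "j < 2 * g \<Longrightarrow> next_mod g i = Suc j \<longleftrightarrow> i = j"
  by (auto simp: next_mod_def)

lemma next_mod_le: "i \<le> 2 * g \<Longrightarrow> next_mod g i \<le> 2 * g"
  by (auto simp: next_mod_def)

lemma mid_next_le: "i \<le> 2 * g \<Longrightarrow> mid_next g i \<le> 2 * g"
  by (auto simp: mid_next_def)

lemma mid_next_eq_iff: "i \<le> 2 * g \<Longrightarrow> j \<le> 2 * g \<Longrightarrow> mid_next g i = mid_next g j \<longleftrightarrow> i = j"
  by (auto simp: mid_next_def)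

text \<open>The base is the shifted diagonal \<open>(i, i + 1)\<close> of the first block. Each
  index in \<open>{1..e}\<close> gives up its cell for three cells in the other blocks, one
  restoring its row, one its column and one its symbol, so a trade adds 2 to the length. The symbol
  to restore is \<open>g + i + 1\<close> modulo \<open>2 * g + 1\<close>; the shift by one in the
  last block puts it on the diagonal at \<open>g + i\<close>, clear of the other trades. The flag
  decides whether the new row and the new column share a cell or get one each, which fixes the
  parity.\<close>

definition pt_4g3 :: "nat \<Rightarrow> nat \<Rightarrow> bool \<Rightarrow> ((nat + nat) \<times> (nat + nat) \<times> (nat + nat)) set" where
  "pt_4g3 g e b = (\<lambda>i. (Inl i, Inl (next_mod g i), Inl (mid_next g i))) ` insert 0 {e<..2 * g}
     \<union> (\<lambda>i. (Inl i, Inr (i - 1), Inr (i + g))) ` {1..e}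
     \<union> (\<lambda>i. (Inr (i - 1), Inl (Suc i), Inr i)) ` {1..e}
     \<union> (\<lambda>i. (Inr (g + i), Inr (g + i), Inl (mid_next g i))) ` {1..e}
     \<union> (if b then {(Inl (Suc (2 * g)), Inl (Suc (2 * g)), Inr (Suc (2 * g)))}
        else {(Inl (Suc (2 * g)), Inr g, Inr g), (Inr (2 * g), Inl (Suc (2 * g)), Inr (2 * g))})"

lemma pt_4g3_unextendable:
  assumes "e + of_bool (\<not> b) \<le> g" "g > 0"
  shows "unextendable_pt ({..Suc (2 * g)} <+> {..2 * g}) ({..Suc (2 * g)} <+> {..2 * g}) (square_4g3 g) (pt_4g3 g e b)"
proof (rule unextendable_ptI)
  have e: "e \<le> g" using assms by simp
  have h: "half (Suc (2 * g)) (i + Suc i) = (mid_next g i)" if "i < 2 * g" for i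
    using that by (auto simp: half_def mid_next_def)
  show "x \<in> {..Suc (2 * g)} <+> {..2 * g} \<and> y \<in> {..Suc (2 * g)} <+> {..2 * g} \<and> square_4g3 g x y = z"
    if xyz: "(x, y, z) \<in> pt_4g3 g e b" for x y z
  proof -
    show ?thesis
      using xyz unfolding pt_4g3_def Un_iff
    proof (elim disjE)
      assume "(x, y, z) \<in> (\<lambda>i. (Inl i, Inl (next_mod g i),
          Inl (mid_next g i))) ` insert 0 {e<..2 * g}"
      then obtain i where i: "i \<le> 2 * g" "x = Inl i" "y = Inl (next_mod g i)"
          "z = Inl (mid_next g i)"
        by auto
      show ?thesis
      proof (cases "i = 2 * g")
        case True
        then show ?thesis using i assms half_double(1)[of "Suc (2 * g)" g] by (simp add: square_4g3_simps InlI next_mod_def mid_next_def)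
      next
        case False
        then show ?thesis using i h[of i] by (simp add: square_4g3_simps InlI next_mod_def mid_next_def)
      qed
    next
      assume "(x, y, z) \<in> (\<lambda>i. (Inl i, Inr (i - 1), Inr (i + g))) ` {1..e}"
      then obtain i where i: "1 \<le> i" "i \<le> e" "x = Inl i" "y = Inr (i - 1)" "z = Inr (i + g)" by auto
      then have "half (Suc (2 * g)) (i + (i - 1)) = i + g" using h[of "i - 1"] e by (simp add: add.commute mid_next_def)
      then show ?thesis using i e by (auto simp: square_4g3_simps)
    next
      assume "(x, y, z) \<in> (\<lambda>i. (Inr (i - 1), Inl (Suc i), Inr i)) ` {1..e}"
      then obtain i where i: "1 \<le> i" "i \<le> e" "x = Inr (i - 1)" "y = Inl (Suc i)" "z = Inr i" by auto
      then have "half (Suc (2 * g)) (i - 1 + Suc i) = i" using half_double(2)[of "Suc (2 * g)" i] by simp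
      then show ?thesis using i e by (auto simp: square_4g3_simps)
    next
      assume "(x, y, z) \<in> (\<lambda>i. (Inr (g + i), Inr (g + i), Inl (mid_next g i))) ` {1..e}"
      then obtain i where i: "1 \<le> i" "i \<le> e" "x = Inr (g + i)" "y = Inr (g + i)"
          "z = Inl (mid_next g i)" by auto
      then show ?thesis using e half_double(2)[of "Suc (2 * g)" "g + i"] by (auto simp: square_4g3_simps mid_next_def)
    next
      assume "(x, y, z) \<in> (if b then {(Inl (Suc (2 * g)), Inl (Suc (2 * g)), Inr (Suc (2 * g)))}
        else {(Inl (Suc (2 * g)), Inr g, Inr g), (Inr (2 * g), Inl (Suc (2 * g)), Inr (2 * g))})"
      then show ?thesis using assms by (auto simp: square_4g3_simps split: if_splits)
    qed
  qed
  have cases: "(\<exists>i\<le>2 * g. (i = 0 \<or> e < i) \<and> x = Inl i \<and> y = Inl (next_mod g i) \<and> z = Inl (mid_next g i))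
      \<or> (\<exists>i. 1 \<le> i \<and> i \<le> e \<and> x = Inl i \<and> y = Inr (i - 1) \<and> z = Inr (i + g))
      \<or> (\<exists>i. 1 \<le> i \<and> i \<le> e \<and> x = Inr (i - 1) \<and> y = Inl (Suc i) \<and> z = Inr i)
      \<or> (\<exists>i. 1 \<le> i \<and> i \<le> e \<and> x = Inr (g + i) \<and> y = Inr (g + i) \<and> z = Inl (mid_next g i))
      \<or> b \<and> x = Inl (Suc (2 * g)) \<and> y = Inl (Suc (2 * g)) \<and> z = Inr (Suc (2 * g))
      \<or> \<not> b \<and> e < g \<and> x = Inl (Suc (2 * g)) \<and> y = Inr g \<and> z = Inr g
      \<or> \<not> b \<and> e < g \<and> x = Inr (2 * g) \<and> y = Inl (Suc (2 * g)) \<and> z = Inr (2 * g)"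
    if "(x, y, z) \<in> pt_4g3 g e b" for x y z
    using that assms unfolding pt_4g3_def by (cases b; auto)
  have casesE: thesis if "(x, y, z) \<in> pt_4g3 g e b"
    "\<And>i. i \<le> 2 * g \<Longrightarrow> i = 0 \<or> e < i \<Longrightarrow> x = Inl i \<Longrightarrow> y = Inl (next_mod g i) \<Longrightarrow> z = Inl (mid_next g i) \<Longrightarrow> thesis"
    "\<And>i. 1 \<le> i \<Longrightarrow> i \<le> e \<Longrightarrow> x = Inl i \<Longrightarrow> y = Inr (i - 1) \<Longrightarrow> z = Inr (i + g) \<Longrightarrow> thesis"
    "\<And>i. 1 \<le> i \<Longrightarrow> i \<le> e \<Longrightarrow> x = Inr (i - 1) \<Longrightarrow> y = Inl (Suc i) \<Longrightarrow> z = Inr i \<Longrightarrow> thesis"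
    "\<And>i. 1 \<le> i \<Longrightarrow> i \<le> e \<Longrightarrow> x = Inr (g + i) \<Longrightarrow> y = Inr (g + i) \<Longrightarrow> z = Inl (mid_next g i) \<Longrightarrow> thesis"
    "b \<Longrightarrow> x = Inl (Suc (2 * g)) \<Longrightarrow> y = Inl (Suc (2 * g)) \<Longrightarrow> z = Inr (Suc (2 * g)) \<Longrightarrow> thesis"
    "\<not> b \<Longrightarrow> e < g \<Longrightarrow> x = Inl (Suc (2 * g)) \<Longrightarrow> y = Inr g \<Longrightarrow> z = Inr g \<Longrightarrow> thesis"
    "\<not> b \<Longrightarrow> e < g \<Longrightarrow> x = Inr (2 * g) \<Longrightarrow> y = Inl (Suc (2 * g)) \<Longrightarrow> z = Inr (2 * g) \<Longrightarrow> thesis"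
    for x y z thesis
    using cases[OF that(1)] that(2-) by blast
  have nz: "next_mod g i \<noteq> Suc (2 * g)" "Suc (2 * g) \<noteq> next_mod g i" if "i \<le> 2 * g" for i
    using next_mod_le[OF that] by auto
  have ns: "next_mod g i = Suc j \<longleftrightarrow> i = j" "Suc j = next_mod g i \<longleftrightarrow> i = j" if "j \<le> g" for i j
    using next_mod_eq_Suc_iff[of j g i] that assms by auto
  show "y = y'" if t: "(x, y, z) \<in> pt_4g3 g e b" "(x, y', z') \<in> pt_4g3 g e b" for x y z y' z'
    using e by - (rule casesE[OF t(1)]; rule casesE[OF t(2)]; simp)
  show "x = x'" if t: "(x, y, z) \<in> pt_4g3 g e b" "(x', y, z') \<in> pt_4g3 g e b" for x y z x' z'
    using e by - (rule casesE[OF t(1)]; rule casesE[OF t(2)]; simp add: next_mod_eq_iff ns nz)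
  show "x = x'" if t: "(x, y, z) \<in> pt_4g3 g e b" "(x', y', z) \<in> pt_4g3 g e b" for x y z x' y'
    using e by - (rule casesE[OF t(1)]; rule casesE[OF t(2)]; simp add: mid_next_eq_iff)
  show "x \<in> rows (pt_4g3 g e b) \<or> y \<in> cols (pt_4g3 g e b) \<or> square_4g3 g x y \<in> syms (pt_4g3 g e b)"
    if xy: "x \<in> {..Suc (2 * g)} <+> {..2 * g}" "y \<in> {..Suc (2 * g)} <+> {..2 * g}" for x y
  proof -
    have A: "(Inl i, Inl (next_mod g i), Inl (mid_next g i)) \<in> pt_4g3 g e b"
      if "i = 0 \<or> e < i" "i \<le> 2 * g" for i
      unfolding pt_4g3_def by (intro UnI1, rule image_eqI[where x = i]) (use that in auto)
    have B: "(Inl i, Inr (i - 1), Inr (i + g)) \<in> pt_4g3 g e b"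
      and C: "(Inr (i - 1), Inl (Suc i), Inr i) \<in> pt_4g3 g e b"
      and D: "(Inr (g + i), Inr (g + i), Inl (mid_next g i)) \<in> pt_4g3 g e b"
      if "1 \<le> i" "i \<le> e" for i
      using that unfolding pt_4g3_def Un_iff by (blast intro: imageI atLeastAtMost_iff[THEN iffD2])+
    have E: "Inl (Suc (2 * g)) \<in> rows (pt_4g3 g e b)" "Inl (Suc (2 * g)) \<in> cols (pt_4g3 g e b)"
      unfolding in_rows in_cols pt_4g3_def by (cases b; auto)+
    have r: "Inl i \<in> rows (pt_4g3 g e b)" if i: "i \<le> Suc (2 * g)" for i
    proof -
      consider "i = Suc (2 * g)" | "i \<le> 2 * g" "i = 0 \<or> e < i" | "1 \<le> i" "i \<le> e" using i by linarith
      then show ?thesis using A B E unfolding in_rows by cases blast+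
    qed
    have c: "Inl j \<in> cols (pt_4g3 g e b)" if j: "j \<le> Suc (2 * g)" for j
    proof -
      consider "j = Suc (2 * g)" | "j = 0" | "j = 1" | i where "e < i" "i < 2 * g" "j = Suc i"
        | i where "1 \<le> i" "i \<le> e" "j = Suc i"
      proof -
        assume *: "j = Suc (2 * g) \<Longrightarrow> thesis" "j = 0 \<Longrightarrow> thesis" "j = 1 \<Longrightarrow> thesis"
          "\<And>i. e < i \<Longrightarrow> i < 2 * g \<Longrightarrow> j = Suc i \<Longrightarrow> thesis" "\<And>i. 1 \<le> i \<Longrightarrow> i \<le> e \<Longrightarrow> j = Suc i \<Longrightarrow> thesis"
        show thesis
        proof (cases "j \<le> 1 \<or> j = Suc (2 * g)")
          case True then show thesis using * by (cases j) auto
        next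
          case False
          then show thesis using *(4,5)[of "j - 1"] j by (cases "e < j - 1") auto
        qed
      qed
      then show ?thesis
      proof cases
        case 1 then show ?thesis using E by simp
      next
        case 2 then show ?thesis using A[of "2 * g"] assms unfolding in_cols next_mod_def by auto
      next
        case 3 then show ?thesis using A[of 0] assms unfolding in_cols next_mod_def by auto
      next
        case 4 then show ?thesis using A[of i] unfolding in_cols next_mod_def by auto
      next
        case 5 then show ?thesis using C[of i] unfolding in_cols by auto
      qed
    qed
    have s: "Inl s \<in> syms (pt_4g3 g e b)" if "s \<le> 2 * g" for s
    proof -
      \<comment> \<open>The inverse of \<open>mid_next g\<close>.\<close>
      define i where "i = (if g < s then s - g - 1 else s + g)"
      have i: "i \<le> 2 * g" "mid_next g i = s" using that by (auto simp: i_def mid_next_def)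
      show ?thesis
      proof (cases "i = 0 \<or> e < i")
        case True then show ?thesis using A[of i] i unfolding in_syms by metis
      next
        case False then show ?thesis using D[of i] i unfolding in_syms by (metis One_nat_def Suc_leI neq0_conv not_le)
      qed
    qed
    have "square_4g3 g x y \<in> {..2 * g} <+> {..Suc (2 * g)}" using square_4g3_latin(1) xy by blast
    then show ?thesis using xy r c s
      by (cases x; cases y) (auto simp: square_4g3_simps)
  qed
qed

lemma pt_4g3_card:
  assumes "e + of_bool (\<not> b) \<le> g" "g > 0"
  shows "card (pt_4g3 g e b) = 2 * g + 2 * e + 2 + of_bool (\<not> b)"
proof -
  define A B C D E :: "((nat + nat) \<times> (nat + nat) \<times> (nat + nat)) set" where
    "A = (\<lambda>i. (Inl i, Inl (next_mod g i), Inl (mid_next g i))) ` insert 0 {e<..2 * g}" and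
    "B = (\<lambda>i. (Inl i, Inr (i - 1), Inr (i + g))) ` {1..e}" and
    "C = (\<lambda>i. (Inr (i - 1), Inl (Suc i), Inr i)) ` {1..e}" and
    "D = (\<lambda>i. (Inr (g + i), Inr (g + i), Inl (mid_next g i))) ` {1..e}" and
    "E = (if b then {(Inl (Suc (2 * g)), Inl (Suc (2 * g)), Inr (Suc (2 * g)))}
        else {(Inl (Suc (2 * g)), Inr g, Inr g), (Inr (2 * g), Inl (Suc (2 * g)), Inr (2 * g))})"
  note defs = A_def B_def C_def D_def E_def
  have fin: "finite A" "finite B" "finite C" "finite D" "finite E" by (simp_all add: defs)
  have "A \<inter> B = {}" "(A \<union> B) \<inter> C = {}" "(A \<union> B \<union> C) \<inter> D = {}" "(A \<union> B \<union> C \<union> D) \<inter> E = {}"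
    using assms by (auto simp: defs split: if_splits)
  then have "card (A \<union> B \<union> C \<union> D \<union> E) = card A + card B + card C + card D + card E"
    using fin by (simp add: card_Un_disjoint)
  moreover have "card A = card (insert 0 {e<..2 * g})" "card B = e" "card C = e" "card D = e"
    unfolding defs by (subst card_image; auto simp: inj_on_def)+
  moreover have "card E = 1 + of_bool (\<not> b)" by (simp add: E_def)
  moreover have "pt_4g3 g e b = A \<union> B \<union> C \<union> D \<union> E" by (simp add: pt_4g3_def defs)
  ultimately show ?thesis using assms by simp
qed

text \<open>As in every symmetric Latin square of odd order, the main diagonal is a transversal.\<close>

lemma square_4g3_diagonal:
  "unextendable_pt ({..Suc (2 * g)} <+> {..2 * g}) ({..Suc (2 * g)} <+> {..2 * g}) (square_4g3 g)
     ((\<lambda>x. (x, x, square_4g3 g x x)) ` ({..Suc (2 * g)} <+> {..2 * g}))"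
proof -
  have "square_4g3 g (Inl i) (Inl i) = Inr i" "square_4g3 g (Inr i) (Inr i) = Inl (if i = 2 * g then 0 else Suc i)" for i
    by (simp_all add: square_4g3_simps half_double)
  then have inj: "x = y" if "square_4g3 g x x = square_4g3 g y y" for x y
    using that by (cases x; cases y) (auto split: if_splits)
  show ?thesis
    by (rule unextendable_ptI) (auto simp: in_rows image_iff dest: inj)
qed

lemma omniversal_4g3:
  assumes "g > 0"
  shows "\<exists>L. omniversal (4 * g + 3) L"
proof (rule ex_omniversal[where Z = "{..2 * g} <+> {..Suc (2 * g)}"])
  show "\<exists>T. unextendable_pt ({..Suc (2 * g)} <+> {..2 * g}) ({..Suc (2 * g)} <+> {..2 * g}) (square_4g3 g) T \<and> card T + d = 4 * g + 3"
    if "2 * d \<le> 4 * g + 3" for d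
  \<comment> \<open>Here \<open>d = 0\<close> would need \<open>e = g\<close> with the flag unset,
    and then two cells would lie in row \<open>Inr (2 * g)\<close>. The main diagonal takes
    over.\<close>
  proof (cases "d = 0")
    case True
    have "inj_on (\<lambda>x. (x, x, square_4g3 g x x)) A" for A by (auto simp: inj_on_def)
    then show ?thesis using square_4g3_diagonal[of g] True by (auto simp: card_image card_Plus)
  next
    case False
    define e where "e = (if even d then g - d div 2 else g - (d - 1) div 2)"
    have "e + of_bool (\<not> odd d) \<le> g"
      using that assms False unfolding e_def by (auto elim!: evenE oddE)
    moreover have "2 * g + 2 * e + 2 + of_bool (\<not> odd d) + d = 4 * g + 3"
      using that False unfolding e_def by (auto elim!: oddE evenE)
    ultimately show ?thesis
      using assms by (intro exI[of _ "pt_4g3 g e (odd d)"] conjI pt_4g3_unextendable) (simp_all add: pt_4g3_card)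
  qed
qed (use square_4g3_latin in \<open>auto simp: card_Plus\<close>)

section \<open>Orders congruent to 1 modulo 4\<close>

text \<open>Rows and columns are residues modulo \<open>m = 2 * g + 1\<close> (\<open>Inl\<close>) and nonzero residues (\<open>Inr\<close>);
  \<open>Inl\<close> symbols are nonzero. The four blocks are \<open>(i + j) / 2\<close>, \<open>(i + j) / 2\<close>, \<open>(i - j) / 2\<close> and a
  relabelled cyclic square of order \<open>2 * g\<close>; where the first block would have symbol 0, namely for
  \<open>i + j = 0\<close>, it takes the \<open>Inr\<close> symbol missing in its row, which is also missing in its column.\<close>

definition square_4g1 :: "nat \<Rightarrow> nat + nat \<Rightarrow> nat + nat \<Rightarrow> nat + nat" where
  "square_4g1 g x y = (let m = 2 * g + 1 in case (x, y) of
     (Inl i, Inl j) \<Rightarrow> if i + j = 0 \<or> i + j = m then Inr (half m i) else Inl (half m (i + j))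
   | (Inl i, Inr j) \<Rightarrow> Inr (half m (i + j))
   | (Inr i, Inl j) \<Rightarrow> Inr (half m (i + (m - j)))
   | (Inr i, Inr j) \<Rightarrow> Inl (half m (if i = j + 1 \<or> i = 1 \<and> j = 2 * g then 2 * g
       else if j < i then i - 1 - j else i - 1 + 2 * g - j)))"

lemma square_4g1_simps:
  "square_4g1 g (Inl i) (Inl j) = (if i + j = 0 \<or> i + j = Suc (2 * g) then Inr (half (Suc (2 * g)) i)
     else Inl (half (Suc (2 * g)) (i + j)))"
  "square_4g1 g (Inl i) (Inr j) = Inr (half (Suc (2 * g)) (i + j))"
  "square_4g1 g (Inr i) (Inl j) = Inr (half (Suc (2 * g)) (i + (Suc (2 * g) - j)))"
  "square_4g1 g (Inr i) (Inr j) = Inl (half (Suc (2 * g)) (if i = j + 1 \<or> i = 1 \<and> j = 2 * g then 2 * g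
       else if j < i then i - 1 - j else i - 1 + 2 * g - j))"
  by (simp_all add: square_4g1_def Let_def)

text \<open>The diagonal cells \<open>1, \<dots>, e\<close> of the first block are traded for \<open>e\<close> cells of each other block.
  The flag is set if the number of unused rows is odd.\<close>

definition pt_4g1 :: "nat \<Rightarrow> nat \<Rightarrow> bool \<Rightarrow> ((nat + nat) \<times> (nat + nat) \<times> (nat + nat)) set" where
  "pt_4g1 g e b = (\<lambda>i. (Inl i, Inl i, Inl i)) ` {e<..2 * g}
     \<union> (\<lambda>i. (Inl i, Inr i, Inr i)) ` {1..e}
     \<union> (\<lambda>i. (Inr (2 * g + 1 - i), Inl i, Inr (2 * g + 1 - i))) ` {1..e}
     \<union> (\<lambda>i. (Inr (if i < g then i + 1 else 1), Inr (2 * g + 1 - (if i < g then i + 1 else 1)), Inl i)) ` {1..e}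
     \<union> (if b then {(Inl 0, Inr (2 * g), Inr g), (Inr 1, Inl 0, Inr (g + 1))} else {(Inl 0, Inl 0, Inr 0)})"

lemma square_4g1_latin:
  fixes g
  defines "X \<equiv> {..2 * g} <+> {1..2 * g}" and "Z \<equiv> {1..2 * g} <+> {..2 * g}"
  shows "x \<in> X \<Longrightarrow> y \<in> X \<Longrightarrow> square_4g1 g x y \<in> Z"
    and "x \<in> X \<Longrightarrow> inj_on (square_4g1 g x) X"
    and "y \<in> X \<Longrightarrow> inj_on (\<lambda>x. square_4g1 g x y) X"
proof -
  have odd: "odd (Suc (2 * g))" by simp
  note eq = half_eq_iff[OF odd] and zero = half_eq_0_iff[OF odd]
  have less: "half (Suc (2 * g)) s \<le> 2 * g" if "s < 2 * (Suc (2 * g))" for s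
    using half_less[OF odd that] by simp
  have pos: "Suc 0 \<le> half (Suc (2 * g)) s" if "s < 2 * (Suc (2 * g))" "s \<noteq> 0" "s \<noteq> Suc (2 * g)" for s
    using zero[OF that(1)] that(2,3) by linarith
  show "square_4g1 g x y \<in> Z" if "x \<in> X" "y \<in> X" for x y
  proof (cases x; cases y)
    fix i j assume "x = Inl i" "y = Inl j"
    then show ?thesis using that less[of i] less[of "i + j"] pos[of "i + j"]
      by (auto simp: X_def Z_def square_4g1_simps)
  next
    fix i j assume "x = Inl i" "y = Inr j"
    then show ?thesis using that less[of "i + j"] by (auto simp: X_def Z_def square_4g1_simps)
  next
    fix i j assume "x = Inr i" "y = Inl j"
    then show ?thesis using that less[of "i + (Suc (2 * g) - j)"] by (auto simp: X_def Z_def square_4g1_simps)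
  next
    fix i j assume xy: "x = Inr i" "y = Inr j"
    \<comment> \<open>The difference \<open>i - 1 - j\<close> modulo \<open>2 * g\<close>,
      represented in \<open>{1..2 * g}\<close>: halving modulo \<open>2 * g + 1\<close> permutes
      this range, so the symbol is nonzero.\<close>
    define s where "s = (if i = j + 1 \<or> i = 1 \<and> j = 2 * g then 2 * g
       else if j < i then i - 1 - j else i - 1 + 2 * g - j)"
    have "0 < s \<and> s \<le> 2 * g" using that xy unfolding X_def s_def by auto
    then have "half (Suc (2 * g)) s \<in> {1..2 * g}" using less[of s] pos[of s] by simp
    then show ?thesis unfolding xy square_4g1_simps s_def[symmetric] Z_def by (intro InlI)
  qed
  show "inj_on (square_4g1 g x) X" if "x \<in> X" for x
  proof (rule inj_onI)
    fix y y' assume "y \<in> X" "y' \<in> X" "square_4g1 g x y = square_4g1 g x y'"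
    then show "y = y'" using that unfolding X_def
      by (cases x; cases y; cases y'; auto simp: square_4g1_simps eq split: if_splits; arith)
  qed
  show "inj_on (\<lambda>x. square_4g1 g x y) X" if "y \<in> X" for y
  proof (rule inj_onI)
    fix x x' assume "x \<in> X" "x' \<in> X" "square_4g1 g x y = square_4g1 g x' y"
    then show "x = x'" using that unfolding X_def
      by (cases y; cases x; cases x'; auto simp: square_4g1_simps eq split: if_splits; arith)
  qed
qed

lemma pt_4g1_unextendable:
  assumes "e + of_bool b \<le> g" "g > 0"
  shows "unextendable_pt ({..2 * g} <+> {1..2 * g}) ({..2 * g} <+> {1..2 * g}) (square_4g1 g) (pt_4g1 g e b)"
proof (rule unextendable_ptI)
  have m: "half (Suc (2 * g)) (2 * g) = g" "half (Suc (2 * g)) 0 = 0" "half (Suc (2 * g)) (1 + (Suc (2 * g))) = g + 1"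
    using half_double(1)[of "Suc (2 * g)" g] half_double(1)[of "Suc (2 * g)" 0] half_double(1)[of "Suc (2 * g)" "g + 1"]
    by simp_all
  show "x \<in> {..2 * g} <+> {1..2 * g} \<and> y \<in> {..2 * g} <+> {1..2 * g} \<and> square_4g1 g x y = z"
    if xyz: "(x, y, z) \<in> pt_4g1 g e b" for x y z
  proof -
    have e: "e \<le> g" using assms by simp
    consider (A) i where "e < i" "i \<le> 2 * g" "(x, y, z) = (Inl i, Inl i, Inl i)"
      | (B) i where "1 \<le> i" "i \<le> e" "(x, y, z) = (Inl i, Inr i, Inr i)"
      | (C) i where "1 \<le> i" "i \<le> e" "(x, y, z) = (Inr (2 * g + 1 - i), Inl i, Inr (2 * g + 1 - i))"
      | (D) i where "1 \<le> i" "i < g" "(x, y, z) = (Inr (i + 1), Inr (2 * g - i), Inl i)"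
      | (D') "(x, y, z) = (Inr 1, Inr (2 * g), Inl g)"
      | (E) "(x, y, z) = (Inl 0, Inr (2 * g), Inr g)" | (F) "(x, y, z) = (Inr 1, Inl 0, Inr (g + 1))"
      | (G) "(x, y, z) = (Inl 0, Inl 0, Inr 0)"
      using xyz e unfolding pt_4g1_def by (auto split: if_splits)
    then show ?thesis
    proof cases
      case A
      then have "i + i \<noteq> Suc (2 * g)" by presburger
      then show ?thesis using A by (auto simp: square_4g1_simps half_double)
    next
      case B then show ?thesis using e by (auto simp: square_4g1_simps half_double)
    next
      case C
      have "half (Suc (2 * g)) (Suc (Suc (4 * g)) - (i + i)) = Suc (2 * g) - i"
        using half_double(1)[of "Suc (2 * g)" "Suc (2 * g) - i"] by (simp add: algebra_simps flip: mult_2)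
      with C show ?thesis using e by (auto simp: square_4g1_simps)
    next
      case D
      then have "i + 1 - 1 + 2 * g - (2 * g - i) = 2 * i" by simp
      with D show ?thesis by (auto simp: square_4g1_simps half_double)
    next
      \<comment> \<open>For \<open>i = g\<close>, which needs \<open>e = g\<close>, the pattern of
        \<open>D\<close> would give the cell \<open>(g + 1, g)\<close>, whose row is taken by
        \<open>C\<close> and whose column is taken by \<open>B\<close>. The cell
        \<open>(1, 2 * g)\<close> has the same symbol and is free.\<close>
      case D' then show ?thesis using assms m by (auto simp: square_4g1_simps)
    next
      case E then show ?thesis using assms m by (auto simp: square_4g1_simps)
    next
      case F then show ?thesis using assms m by (auto simp: square_4g1_simps)
    next
      case G then show ?thesis using assms m by (auto simp: square_4g1_simps)
    qed
  qed
  show "y = y'" if "(x, y, z) \<in> pt_4g1 g e b" "(x, y', z') \<in> pt_4g1 g e b" for x y z y' z'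
    using that assms unfolding pt_4g1_def by (auto split: if_splits)
  show "x = x'" if "(x, y, z) \<in> pt_4g1 g e b" "(x', y, z') \<in> pt_4g1 g e b" for x y z x' z'
    using that assms unfolding pt_4g1_def by (auto split: if_splits)
  show "x = x'" if "(x, y, z) \<in> pt_4g1 g e b" "(x', y', z) \<in> pt_4g1 g e b" for x y z x' y'
    using that assms unfolding pt_4g1_def by (auto split: if_splits)
  show "x \<in> rows (pt_4g1 g e b) \<or> y \<in> cols (pt_4g1 g e b) \<or> square_4g1 g x y \<in> syms (pt_4g1 g e b)"
    if xy: "x \<in> {..2 * g} <+> {1..2 * g}" "y \<in> {..2 * g} <+> {1..2 * g}" for x y
  proof -
    have A: "(Inl i, Inl i, Inl i) \<in> pt_4g1 g e b" if "e < i" "i \<le> 2 * g" for i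
      using that by (auto simp: pt_4g1_def)
    have B: "(Inl i, Inr i, Inr i) \<in> pt_4g1 g e b"
      and C: "(Inr (2 * g + 1 - i), Inl i, Inr (2 * g + 1 - i)) \<in> pt_4g1 g e b"
      and D: "(Inr (if i < g then i + 1 else 1), Inr (2 * g + 1 - (if i < g then i + 1 else 1)), Inl i) \<in> pt_4g1 g e b"
      if "1 \<le> i" "i \<le> e" for i
      using that unfolding pt_4g1_def Un_iff by (blast intro: imageI atLeastAtMost_iff[THEN iffD2])+
    have E: "Inl 0 \<in> rows (pt_4g1 g e b)" "Inl 0 \<in> cols (pt_4g1 g e b)"
      unfolding in_rows in_cols pt_4g1_def by (cases b; auto)+
    have "Inl i \<in> rows (pt_4g1 g e b) \<and> Inl i \<in> cols (pt_4g1 g e b)" if "i \<le> 2 * g" for i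
    proof (cases "i = 0")
      case False
      then show ?thesis
        using that A[of i] B[of i] C[of i] unfolding in_rows in_cols
        by (cases "i \<le> e") (metis One_nat_def Suc_leI neq0_conv not_le)+
    qed (use E in auto)
    moreover have "Inl i \<in> syms (pt_4g1 g e b)" if "i \<in> {1..2 * g}" for i
      using that A[of i] D[of i] unfolding in_syms atLeastAtMost_iff by (metis not_le)
    moreover have "square_4g1 g x y \<in> {1..2 * g} <+> {..2 * g}" using square_4g1_latin(1) xy by blast
    ultimately show ?thesis using xy
      by (cases x; cases y) (auto simp: square_4g1_simps)
  qed
qed

lemma pt_4g1_card:
  assumes "e + of_bool b \<le> g" "g > 0"
  shows "card (pt_4g1 g e b) = 2 * g + 2 * e + 1 + of_bool b"
proof -
  define A B C D E :: "((nat + nat) \<times> (nat + nat) \<times> (nat + nat)) set" where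
    "A = (\<lambda>i. (Inl i, Inl i, Inl i)) ` {e<..2 * g}" and
    "B = (\<lambda>i. (Inl i, Inr i, Inr i)) ` {1..e}" and
    "C = (\<lambda>i. (Inr (2 * g + 1 - i), Inl i, Inr (2 * g + 1 - i))) ` {1..e}" and
    "D = (\<lambda>i. (Inr (if i < g then i + 1 else 1), Inr (2 * g + 1 - (if i < g then i + 1 else 1)), Inl i)) ` {1..e}" and
    "E = (if b then {(Inl 0, Inr (2 * g), Inr g), (Inr 1, Inl 0, Inr (g + 1))} else {(Inl 0, Inl 0, Inr 0)})"
  note defs = A_def B_def C_def D_def E_def
  have fin: "finite A" "finite B" "finite C" "finite D" "finite E" by (simp_all add: defs)
  have "A \<inter> B = {}" "(A \<union> B) \<inter> C = {}" "(A \<union> B \<union> C) \<inter> D = {}" "(A \<union> B \<union> C \<union> D) \<inter> E = {}"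
    by (auto simp: defs split: if_splits)
  then have "card (A \<union> B \<union> C \<union> D \<union> E) = card A + card B + card C + card D + card E"
    using fin by (simp add: card_Un_disjoint)
  moreover have "card A = 2 * g - e" "card B = e" "card C = e" "card D = e"
    unfolding defs by (subst card_image; auto simp: inj_on_def)+
  moreover have "card E = 1 + of_bool b" by (simp add: E_def)
  moreover have "pt_4g1 g e b = A \<union> B \<union> C \<union> D \<union> E" by (simp add: pt_4g1_def defs)
  ultimately show ?thesis using assms by simp
qed

lemma omniversal_4g1:
  assumes "g > 0"
  shows "\<exists>L. omniversal (4 * g + 1) L"
proof (rule ex_omniversal[where Z = "{1..2 * g} <+> {..2 * g}"])
  show "\<exists>T. unextendable_pt ({..2 * g} <+> {1..2 * g}) ({..2 * g} <+> {1..2 * g}) (square_4g1 g) T \<and> card T + d = 4 * g + 1"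
    if "2 * d \<le> 4 * g + 1" for d
  proof -
    define e where "e = (if even d then g - d div 2 else g - (d + 1) div 2)"
    have "e + of_bool (odd d) \<le> g"
      using that assms unfolding e_def by (auto elim!: oddE)
    moreover have "2 * g + 2 * e + 1 + of_bool (odd d) + d = 4 * g + 1"
      using that unfolding e_def by (auto elim!: oddE evenE)
    ultimately show ?thesis
      using pt_4g1_unextendable pt_4g1_card assms by metis
  qed
qed (use square_4g1_latin in \<open>auto simp: card_Plus\<close>)

section \<open>Idempotent Latin squares\<close>

definition idempotent_latin :: "nat \<Rightarrow> (nat \<Rightarrow> nat \<Rightarrow> nat) \<Rightarrow> bool" where
  "idempotent_latin h Q \<longleftrightarrow> (\<forall>x<h. \<forall>y<h. Q x y < h) \<and> (\<forall>x<h. Q x x = x) \<and>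
     (\<forall>x<h. \<forall>y<h. \<forall>z<h. Q x y = Q x z \<longrightarrow> y = z) \<and> (\<forall>x<h. \<forall>y<h. \<forall>z<h. Q y x = Q z x \<longrightarrow> y = z)"

lemma idempotent_latinD:
  assumes "idempotent_latin h Q"
  shows "x < h \<Longrightarrow> y < h \<Longrightarrow> Q x y < h" "x < h \<Longrightarrow> Q x x = x"
    and "x < h \<Longrightarrow> y < h \<Longrightarrow> z < h \<Longrightarrow> Q x y = Q x z \<Longrightarrow> y = z"
    and "x < h \<Longrightarrow> y < h \<Longrightarrow> z < h \<Longrightarrow> Q y x = Q z x \<Longrightarrow> y = z"
proof -
  note Q = assms[unfolded idempotent_latin_def]
  show "x < h \<Longrightarrow> y < h \<Longrightarrow> Q x y < h" by (rule Q[THEN conjunct1, rule_format])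
  show "x < h \<Longrightarrow> Q x x = x" by (rule Q[THEN conjunct2, THEN conjunct1, rule_format])
  show "x < h \<Longrightarrow> y < h \<Longrightarrow> z < h \<Longrightarrow> Q x y = Q x z \<Longrightarrow> y = z"
    by (rule Q[THEN conjunct2, THEN conjunct2, THEN conjunct1, rule_format])
  show "x < h \<Longrightarrow> y < h \<Longrightarrow> z < h \<Longrightarrow> Q y x = Q z x \<Longrightarrow> y = z"
    by (rule Q[THEN conjunct2, THEN conjunct2, THEN conjunct2, rule_format])
qed

lemma idempotent_latin_odd:
  assumes "odd h"
  shows "idempotent_latin h (\<lambda>x y. half h (x + y))"
  using half_eq_iff[OF assms] half_less[OF assms]
  by (auto simp: idempotent_latin_def half_double)

text \<open>Prolongation of the idempotent square of odd order \<open>q = 2 * g + 1\<close> along the transversal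
  formed by the cells \<open>(x, x + 1)\<close>; the new index is \<open>q\<close>.\<close>

definition prolong :: "nat \<Rightarrow> nat \<Rightarrow> nat \<Rightarrow> nat" where
  "prolong g x y = (let q = Suc (2 * g); prev = (\<lambda>y. if y = 0 then 2 * g else y - 1) in
     if x = q \<and> y = q then q else if y = q then mid_next g x else if x = q then mid_next g (prev y)
     else if y = next_mod g x then q else half q (x + y))"

text \<open>For \<open>g > 0\<close> the transversal used for the prolongation avoids the main
  diagonal, so idempotence survives. The case \<open>g = 0\<close> would be order 2, where no
  idempotent Latin square exists.\<close>

lemma idempotent_latin_even:
  assumes "g > 0"
  shows "idempotent_latin (2 * g + 2) (prolong g)"
proof -
  let ?q = "Suc (2 * g)"
  define prev where "prev y = (if y = 0 then 2 * g else y - 1)" for y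
  have Q: "prolong g x y = (if x = ?q \<and> y = ?q then ?q else if y = ?q then mid_next g x else if x = ?q then mid_next g (prev y)
     else if y = next_mod g x then ?q else half ?q (x + y))" for x y
    by (simp add: prolong_def prev_def Let_def)
  have odd: "odd ?q" by simp
  have less: "half ?q (i + j) \<le> 2 * g" if "i \<le> 2 * g" "j \<le> 2 * g" for i j
    using half_less[OF odd, of "i + j"] that by simp
  have ne: "half ?q (i + j) \<noteq> ?q" if "i \<le> 2 * g" "j \<le> 2 * g" for i j
    using less[OF that] by simp
  have cancel: "half ?q (i + j) = half ?q (i + j') \<longleftrightarrow> j = j'" "half ?q (j + i) = half ?q (j' + i) \<longleftrightarrow> j = j'"
    if "i \<le> 2 * g" "j \<le> 2 * g" "j' \<le> 2 * g" for i j j'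
    using half_eq_iff[OF odd, of "i + j" "i + j'"] that by (auto simp: add.commute)
  have nx: "next_mod g x \<le> 2 * g" "next_mod g x \<noteq> x" "x \<noteq> next_mod g x" if "x \<le> 2 * g" for x
    using that assms by (auto simp: next_mod_def)
  have pl: "prev y \<le> 2 * g" if "y \<le> 2 * g" for y using that by (auto simp: prev_def)
  have np: "y = next_mod g x \<longleftrightarrow> x = prev y" if "x \<le> 2 * g" "y \<le> 2 * g" for x y
    using that by (auto simp: next_mod_def prev_def)
  \<comment> \<open>So \<open>mid_next g x\<close> is the symbol that the cell
    \<open>(x, next_mod g x)\<close> cedes to the new index. It reappears in the new column at row
    \<open>x\<close> and in the new row at column \<open>next_mod g x\<close>.\<close>
  have mid: "mid_next g x = half ?q (x + next_mod g x)" if "x \<le> 2 * g" for x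
  proof (cases "x = 2 * g")
    case True
    then show ?thesis using half_double(1)[of ?q g] assms by (simp add: mid_next_def next_mod_def)
  next
    case False
    then show ?thesis using that by (auto simp: mid_next_def next_mod_def half_def)
  qed
  have mid': "mid_next g (prev y) = half ?q (prev y + y)" if "y \<le> 2 * g" for y
    using mid[OF pl[OF that]] np[OF pl[OF that] that] by simp
  have mne: "mid_next g x \<noteq> ?q" if "x \<le> 2 * g" for x using mid_next_le[OF that] by simp
  have E: thesis if "x < 2 * g + 2" "x = ?q \<Longrightarrow> thesis" "x \<le> 2 * g \<Longrightarrow> x \<noteq> ?q \<Longrightarrow> thesis" for x thesis
    using that by linarith
  have pinj: "prev y = prev z \<longleftrightarrow> y = z" if "y \<le> 2 * g" "z \<le> 2 * g" for y z
    using that by (auto simp: prev_def)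
  have "prolong g x y < 2 * g + 2" if "x < 2 * g + 2" "y < 2 * g + 2" for x y
  proof -
    have "prolong g x y \<le> ?q"
      by (rule E[OF that(1)]; rule E[OF that(2)]; simp add: Q less mid_next_le pl le_SucI)
    then show ?thesis by simp
  qed
  moreover have "prolong g x x = x" if "x < 2 * g + 2" for x
    by (rule E[OF that]) (use nx in \<open>auto simp: Q half_double\<close>)
  moreover have "y = z" if "x < 2 * g + 2" and y: "y < 2 * g + 2" and z: "z < 2 * g + 2"
    and eq: "prolong g x y = prolong g x z" for x y z
  proof (rule E[OF that(1)])
    assume "x = ?q"
    with eq show ?thesis
      by - (rule E[OF y]; rule E[OF z]; simp add: Q mne pl mne[symmetric] mid_next_eq_iff pinj)
  next
    assume "x \<le> 2 * g" "x \<noteq> ?q"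
    with eq show ?thesis using nx[of x]
      by - (rule E[OF y]; rule E[OF z]; simp add: Q mid cancel ne ne[symmetric] split: if_splits)
  qed
  moreover have "y = z" if "x < 2 * g + 2" and y: "y < 2 * g + 2" and z: "z < 2 * g + 2"
    and eq: "prolong g y x = prolong g z x" for x y z
  proof (rule E[OF that(1)])
    assume "x = ?q"
    with eq show ?thesis
      by - (rule E[OF y]; rule E[OF z]; simp add: Q mne mne[symmetric] mid_next_eq_iff)
  next
    assume "x \<le> 2 * g" "x \<noteq> ?q"
    with eq show ?thesis using pl[of x]
      by - (rule E[OF y]; rule E[OF z]; simp add: Q mid' np cancel ne ne[symmetric] split: if_splits)
  qed
  ultimately show ?thesis unfolding idempotent_latin_def by blast
qed

text \<open>Idempotence keeps \<open>Q 0 1\<close> away from 0 and 1. Conjugating by the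
  transposition of this value with 2 therefore fixes 0 and 1, and it preserves idempotence. The
  normalisation pins down the intercalate to be switched later.\<close>

lemma idempotent_latin_exists:
  assumes "h \<ge> 3"
  shows "\<exists>Q. idempotent_latin h Q \<and> Q 0 1 = 2"
proof -
  obtain Q where Q: "idempotent_latin h Q"
  proof (cases "odd h")
    case True
    then show thesis using idempotent_latin_odd that by blast
  next
    case False
    then have "h = 2 * ((h - 2) div 2) + 2" "(h - 2) div 2 > 0" using assms by presburger+
    then show thesis using idempotent_latin_even that by metis
  qed
  note D = idempotent_latinD[OF Q]
  define p where "p = Q 0 1"
  have h: "0 < h" "1 < h" "2 < h" using assms by auto
  have p: "p < h" "p \<noteq> 0" "p \<noteq> 1"
    using D(1)[OF h(1,2)] D(2)[OF h(1)] D(2)[OF h(2)] D(3)[OF h(1,2,1)] D(4)[OF h(2,1,2)]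
    unfolding p_def by auto
  define f where "f x = (if x = p then 2 else if x = 2 then p else x)" for x
  have ff: "f (f x) = x" for x using p by (auto simp: f_def)
  have fl: "f x < h" if "x < h" for x using p h that by (auto simp: f_def)
  have inj: "x = y" if "f x = f y" for x y using ff that by metis
  have "idempotent_latin h (\<lambda>x y. f (Q (f x) (f y)))"
    unfolding idempotent_latin_def
  proof (intro conjI allI impI)
    fix x y z assume x: "x < h" and y: "y < h" and z: "z < h"
    show "y = z" if "f (Q (f x) (f y)) = f (Q (f x) (f z))"
      using D(3)[OF fl[OF x] fl[OF y] fl[OF z]] inj[OF that] inj by auto
    show "y = z" if "f (Q (f y) (f x)) = f (Q (f z) (f x))"
      using D(4)[OF fl[OF x] fl[OF y] fl[OF z]] inj[OF that] inj by auto
  qed (simp_all add: ff D(1) D(2) fl)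
  moreover have "f 0 = 0" "f 1 = 1" "f p = 2" using p by (simp_all add: f_def)
  then have "f (Q (f 0) (f 1)) = 2" by (simp add: p_def)
  ultimately show ?thesis by blast
qed

section \<open>Orders divisible by 4\<close>

text \<open>Rows, columns and symbols are pairs of a class in \<open>{..<4}\<close> and an index in \<open>{..<s + 2 * g}\<close>.
  The first \<open>s\<close> indices are special, the others come in pairs \<open>s + 2 * p\<close>, \<open>s + 2 * p + 1\<close>.\<close>

definition partner :: "nat \<Rightarrow> nat \<Rightarrow> nat" where
  "partner s x = (if even (x - s) then x + 1 else x - 1)"

definition relabel_sym :: "nat \<Rightarrow> nat list list list \<Rightarrow> nat list list \<Rightarrow> nat \<Rightarrow> nat \<Rightarrow> nat \<Rightarrow> nat" where
  "relabel_sym s B G i j x = (if x < s then B ! i ! j ! x else if G ! i ! j = 1 then partner s x else x)"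

text \<open>The exchange in block \<open>(1, 1)\<close> makes the corner of the intercalate in that
  block come from the diagonal entry \<open>Q 0 0\<close>, while the other three corners come from
  \<open>Q 0 1\<close>.\<close>

definition relabel_col :: "nat \<Rightarrow> nat \<Rightarrow> nat \<Rightarrow> nat" where
  "relabel_col i j y = (if i = 1 \<and> j = 1 then (if y = 0 then 1 else if y = 1 then 0 else y) else y)"

definition block_square ::
  "nat \<Rightarrow> nat list list list \<Rightarrow> nat list list \<Rightarrow> (nat \<Rightarrow> nat \<Rightarrow> nat) \<Rightarrow> nat \<times> nat \<Rightarrow> nat \<times> nat \<Rightarrow> nat \<times> nat" where
  "block_square s B G Q = (\<lambda>(i, x) (j, y). (xor i j, relabel_sym s B G i j (Q x (relabel_col i j y))))"

text \<open>With \<open>Q 0 0 = 0\<close> and \<open>Q 0 1 = 2\<close>, the relabelling conditions stated below turn these four cells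
  into an intercalate.\<close>

definition in_intercalate :: "nat \<times> nat \<Rightarrow> nat \<times> nat \<Rightarrow> bool" where
  "in_intercalate = (\<lambda>(i, x) (j, y). i < 2 \<and> j < 2 \<and> x = 0 \<and> y = 1)"

definition switched_square ::
  "nat \<Rightarrow> nat list list list \<Rightarrow> nat list list \<Rightarrow> (nat \<Rightarrow> nat \<Rightarrow> nat) \<Rightarrow> nat \<times> nat \<Rightarrow> nat \<times> nat \<Rightarrow> nat \<times> nat" where
  "switched_square s B G Q r c =
     (if in_intercalate r c then (if fst r = fst c then 1 else 0, 2) else block_square s B G Q r c)"

text \<open>The quantifiers run over lists, here and in the later checks, so that concrete tables
  can be verified by evaluation.\<close>

definition relabelling_ok :: "nat \<Rightarrow> nat list list list \<Rightarrow> bool" where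
  "relabelling_ok s B \<longleftrightarrow> 3 \<le> s \<and>
     (\<forall>i\<in>set [0..<4]. \<forall>j\<in>set [0..<4]. length (B ! i ! j) = s \<and> distinct (B ! i ! j) \<and>
        (\<forall>x\<in>set (B ! i ! j). x < s)) \<and>
     B ! 0 ! 0 ! 2 = 2 \<and> B ! 0 ! 1 ! 2 = 2 \<and> B ! 1 ! 0 ! 2 = 2 \<and> B ! 1 ! 1 ! 0 = 2"

lemma xor_less_4: "i < 4 \<Longrightarrow> j < 4 \<Longrightarrow> xor i j < (4::nat)"
proof -
  have "\<forall>i\<in>set [0..<4]. \<forall>j\<in>set [0..<4]. xor i j < (4::nat)" by code_simp
  then show "i < 4 \<Longrightarrow> j < 4 \<Longrightarrow> xor i j < (4::nat)" by simp
qed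

lemma xor_cancel: "xor i j = xor i k \<longleftrightarrow> j = k" "xor j i = xor k i \<longleftrightarrow> j = k" for i j k :: nat
  by (metis xor.assoc xor.commute xor_self_eq xor.right_neutral)+

locale blocks =
  fixes s g h :: nat and B :: "nat list list list" and G :: "nat list list" and Q :: "nat \<Rightarrow> nat \<Rightarrow> nat"
  assumes table: "relabelling_ok s B" and h: "h = s + 2 * g" and Q: "idempotent_latin h Q" "Q 0 1 = 2"
begin

abbreviation "K \<equiv> {..<4::nat} \<times> {..<h}"
abbreviation "L \<equiv> switched_square s B G Q"

lemma s3: "3 \<le> s" "3 \<le> h" using table h by (simp_all add: relabelling_ok_def)

lemma B_props:
  assumes "i < 4" "j < 4"
  shows "length (B ! i ! j) = s" "distinct (B ! i ! j)" "x < s \<Longrightarrow> B ! i ! j ! x < s"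
  using table assms unfolding relabelling_ok_def by (auto simp: all_set_conv_all_nth)

lemma partner:
  assumes "s \<le> x" "x < h"
  shows "s \<le> partner s x" "partner s x < h" "partner s (partner s x) = x"
proof -
  define k where "k = (x - s) div 2"
  have k: "k < g" using assms h unfolding k_def by linarith
  have "x = s + 2 * k \<or> x = s + 2 * k + 1" using assms(1) unfolding k_def by presburger
  then have "s \<le> partner s x \<and> partner s x < h \<and> partner s (partner s x) = x"
    by (rule disjE) (use k in \<open>simp_all add: partner_def h\<close>)
  then show "s \<le> partner s x" "partner s x < h" "partner s (partner s x) = x" by simp_all
qed

lemma relabel_sym_less: "i < 4 \<Longrightarrow> j < 4 \<Longrightarrow> x < h \<Longrightarrow> relabel_sym s B G i j x < h"
  using B_props(3)[of i j x] partner[of x] h by (auto simp: relabel_sym_def)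

lemma relabel_sym_inj:
  assumes "i < 4" "j < 4" "x < h" "y < h" "relabel_sym s B G i j x = relabel_sym s B G i j y"
  shows "x = y"
proof -
  have sp: "relabel_sym s B G i j z < s \<longleftrightarrow> z < s" if "z < h" for z
    using that B_props(3)[OF assms(1,2), of z] partner[of z] by (auto simp: relabel_sym_def)
  show ?thesis
  proof (cases "x < s")
    case True
    then have "y < s" using sp assms by metis
    then show ?thesis using True assms B_props(1,2)[OF assms(1,2)]
      by (auto simp: relabel_sym_def nth_eq_iff_index_eq)
  next
    case False
    then have "\<not> y < s" using sp assms by metis
    show ?thesis
    proof (cases "G ! i ! j = 1")
      case True
      then have "partner s x = partner s y" using \<open>\<not> y < s\<close> False assms(5) by (simp add: relabel_sym_def)
      then have "partner s (partner s x) = partner s (partner s y)" by simp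
      then show ?thesis using \<open>\<not> y < s\<close> False assms(3,4) partner(3) by simp
    qed (use \<open>\<not> y < s\<close> False assms(5) in \<open>simp add: relabel_sym_def\<close>)
  qed
qed

lemma relabel_col: "y < h \<Longrightarrow> relabel_col i j y < h" "relabel_col i j y = relabel_col i j z \<longleftrightarrow> y = z"
  using s3 by (auto simp: relabel_col_def)

lemma block_square_mem: "r \<in> K \<Longrightarrow> c \<in> K \<Longrightarrow> block_square s B G Q r c \<in> K"
  using idempotent_latinD(1)[OF Q(1)] relabel_sym_less relabel_col(1)
  by (auto simp: block_square_def xor_less_4)

lemma block_square_row_inj:
  assumes "r \<in> K" "c \<in> K" "c' \<in> K" "block_square s B G Q r c = block_square s B G Q r c'"
  shows "c = c'"
proof -
  obtain i x j y j' y' where [simp]: "r = (i, x)" "c = (j, y)" "c' = (j', y')" by (cases r; cases c; cases c')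
  have lt: "i < 4" "j < 4" "x < h" "y < h" "y' < h" using assms by auto
  have j: "j = j'" using assms(4) by (simp add: block_square_def xor_cancel)
  then have "relabel_sym s B G i j (Q x (relabel_col i j y)) = relabel_sym s B G i j (Q x (relabel_col i j y'))"
    using assms(4) by (simp add: block_square_def)
  from relabel_sym_inj[OF lt(1,2) _ _ this] have "Q x (relabel_col i j y) = Q x (relabel_col i j y')"
    using idempotent_latinD(1)[OF Q(1)] relabel_col(1) lt by simp
  then have "relabel_col i j y = relabel_col i j y'"
    by (rule idempotent_latinD(3)[OF Q(1), rotated 3]) (use lt relabel_col(1) in auto)
  then show ?thesis using j by (simp add: relabel_col(2))
qed

lemma block_square_col_inj:
  assumes "r \<in> K" "r' \<in> K" "c \<in> K" "block_square s B G Q r c = block_square s B G Q r' c"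
  shows "r = r'"
proof -
  obtain i x j y i' x' where [simp]: "r = (i, x)" "c = (j, y)" "r' = (i', x')" by (cases r; cases c; cases r')
  have lt: "i < 4" "j < 4" "x < h" "y < h" "x' < h" using assms by auto
  have i: "i = i'" using assms(4) by (simp add: block_square_def xor_cancel)
  then have "relabel_sym s B G i j (Q x (relabel_col i j y)) = relabel_sym s B G i j (Q x' (relabel_col i j y))"
    using assms(4) by (simp add: block_square_def)
  from relabel_sym_inj[OF lt(1,2) _ _ this] have "Q x (relabel_col i j y) = Q x' (relabel_col i j y)"
    using idempotent_latinD(1)[OF Q(1)] relabel_col(1) lt by simp
  then have "x = x'"
    by (rule idempotent_latinD(4)[OF Q(1), rotated 3]) (use lt relabel_col(1) in auto)
  then show ?thesis using i by simp
qed

lemma intercalate: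
  assumes "i < 2" "j < 2"
  shows "block_square s B G Q (i, 0) (j, 1) = (if i = j then 0 else 1, 2)"
proof -
  have "Q 0 0 = 0" using idempotent_latinD(2)[OF Q(1)] s3 by simp
  moreover have "i = 0 \<or> i = 1" "j = 0 \<or> j = 1" using assms by auto
  ultimately show ?thesis
    using Q(2) table s3 unfolding relabelling_ok_def
    by (elim disjE; simp add: block_square_def relabel_sym_def relabel_col_def)
qed

text \<open>Switching an intercalate permutes two cells in each row and in each column that it meets.\<close>

lemma switched_row:
  assumes "i < 2"
  shows "L (i, 0) c = block_square s B G Q (i, 0) (if c = (0, 1) then (1, 1) else if c = (1, 1) then (0, 1) else c)"
  using assms intercalate[of i 0] intercalate[of i 1]
  by (cases c) (auto simp: switched_square_def in_intercalate_def less_2_cases_iff)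

lemma switched_col:
  assumes "j < 2"
  shows "L r (j, 1) = block_square s B G Q (if r = (0, 0) then (1, 0) else if r = (1, 0) then (0, 0) else r) (j, 1)"
  using assms intercalate[of 0 j] intercalate[of 1 j]
  by (cases r) (auto simp: switched_square_def in_intercalate_def less_2_cases_iff)

lemma switched_latin:
  shows "r \<in> K \<Longrightarrow> c \<in> K \<Longrightarrow> L r c \<in> K" "r \<in> K \<Longrightarrow> inj_on (L r) K" "c \<in> K \<Longrightarrow> inj_on (\<lambda>r. L r c) K"
proof -
  show "L r c \<in> K" if "r \<in> K" "c \<in> K"
    using block_square_mem[OF that] s3 by (auto simp: switched_square_def)
  show "inj_on (L r) K" if r: "r \<in> K"
  proof (cases "snd r = 0 \<and> fst r < 2")
    case True
    then obtain i where i: "r = (i, 0)" "i < 2" by (cases r) auto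
    show ?thesis
    proof (rule inj_onI)
      fix c c' assume c: "c \<in> K" "c' \<in> K" "L r c = L r c'"
      let ?f = "\<lambda>c. if c = (0, 1) then (1, 1) else if c = (1, 1) then (0, 1) else c :: nat \<times> nat"
      have f: "?f c \<in> K" "?f c' \<in> K" using c s3 by auto
      have "block_square s B G Q r (?f c) = block_square s B G Q r (?f c')"
        using c(3) unfolding i switched_row[OF i(2)] .
      then have "?f c = ?f c'" by (rule block_square_row_inj[OF r f])
      then show "c = c'" by (auto split: if_splits)
    qed
  next
    case False
    then have "L r c = block_square s B G Q r c" for c
      by (cases r; cases c) (auto simp: switched_square_def in_intercalate_def)
    then show ?thesis using block_square_row_inj[OF r] by (auto simp: inj_on_def)
  qed
  show "inj_on (\<lambda>r. L r c) K" if c: "c \<in> K"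
  proof (cases "snd c = 1 \<and> fst c < 2")
    case True
    then obtain j where j: "c = (j, 1)" "j < 2" by (cases c) auto
    show ?thesis
    proof (rule inj_onI)
      fix r r' assume r: "r \<in> K" "r' \<in> K" "L r c = L r' c"
      let ?f = "\<lambda>c. if c = (0, 0) then (1, 0) else if c = (1, 0) then (0, 0) else c :: nat \<times> nat"
      have f: "?f r \<in> K" "?f r' \<in> K" using r s3 by auto
      have "block_square s B G Q (?f r) c = block_square s B G Q (?f r') c"
        using r(3) unfolding j switched_col[OF j(2)] .
      then have "?f r = ?f r'" by (rule block_square_col_inj[OF f c])
      then show "r = r'" by (auto split: if_splits)
    qed
  next
    case False
    then have "L r c = block_square s B G Q r c" for r
      by (cases r; cases c) (auto simp: switched_square_def in_intercalate_def)
    then show ?thesis using block_square_col_inj[OF _ _ c] by (auto simp: inj_on_def)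
  qed
qed

end

section \<open>Partial transversals assembled from orbits\<close>

definition special_cells :: "nat list list list \<Rightarrow> (nat \<times> nat \<times> nat \<times> nat) list \<Rightarrow> ((nat \<times> nat) \<times> (nat \<times> nat) \<times> (nat \<times> nat)) list" where
  "special_cells B = map (\<lambda>(i, x, j, y). ((i, x), (j, y),
     if in_intercalate (i, x) (j, y) then (if i = j then 1 else 0, 2) else (xor i j, B ! i ! j ! x)))"

text \<open>A single model serves all generic pairs: \<open>t\<close> is the position within the
  pair, and \<open>1 - t\<close> is the position of its \<open>partner\<close>.\<close>

definition generic_cells :: "nat list list \<Rightarrow> (nat \<times> nat \<times> nat) list \<Rightarrow> ((nat \<times> nat) \<times> (nat \<times> nat) \<times> (nat \<times> nat)) list" where
  "generic_cells G = map (\<lambda>(i, t, j). ((i, t), (j, t), (xor i j, if G ! i ! j = 1 then 1 - t else t)))"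

definition on_diagonal :: "(nat \<times> nat \<times> nat \<times> nat) list \<Rightarrow> bool" where
  "on_diagonal S \<longleftrightarrow> (\<forall>(i, x, j, y) \<in> set S. in_intercalate (i, x) (j, y) \<or> relabel_col i j y = x)"

text \<open>\<open>M\<close> lists the classes of rows and columns and \<open>N\<close> the classes of symbols that must be used
  completely.\<close>

definition cells_ok :: "nat \<Rightarrow> nat list \<Rightarrow> nat list \<Rightarrow> ((nat \<times> nat) \<times> (nat \<times> nat) \<times> (nat \<times> nat)) list \<Rightarrow> bool" where
  "cells_ok w M N E \<longleftrightarrow>
     (\<forall>((i, x), (j, y), (k, z)) \<in> set E. i < 4 \<and> x < w \<and> j < 4 \<and> y < w \<and> k < 4 \<and> z < w) \<and>
     distinct (map fst E) \<and> distinct (map (\<lambda>e. fst (snd e)) E) \<and> distinct (map (\<lambda>e. snd (snd e)) E) \<and>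
     (\<forall>i\<in>set M. \<forall>x\<in>set [0..<w]. (i, x) \<in> set (map fst E) \<and> (i, x) \<in> set (map (\<lambda>e. fst (snd e)) E)) \<and>
     (\<forall>k\<in>set N. \<forall>x\<in>set [0..<w]. (k, x) \<in> set (map (\<lambda>e. snd (snd e)) E))"

text \<open>This expresses a splitting: once the rows and columns of \<open>M\<close> are used up,
  the remaining cells of the unswitched square carry symbols from the classes \<open>N\<close>
  only.\<close>

definition classes_ok :: "nat list \<Rightarrow> nat list \<Rightarrow> bool" where
  "classes_ok M N \<longleftrightarrow> (\<forall>i\<in>set [0..<4]. \<forall>j\<in>set [0..<4]. i \<notin> set M \<longrightarrow> j \<notin> set M \<longrightarrow> xor i j \<in> set N)"

lemma cells_okD:
  assumes "cells_ok w M N E"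
  shows "((i, x), (j, y), (k, z)) \<in> set E \<Longrightarrow> i < 4 \<and> x < w \<and> j < 4 \<and> y < w \<and> k < 4 \<and> z < w"
    and "distinct E"
    and "(a, b, c) \<in> set E \<Longrightarrow> (a, b', c') \<in> set E \<Longrightarrow> b = b' \<and> c = c'"
    and "(a, b, c) \<in> set E \<Longrightarrow> (a', b, c') \<in> set E \<Longrightarrow> a = a'"
    and "(a, b, c) \<in> set E \<Longrightarrow> (a', b', c) \<in> set E \<Longrightarrow> a = a'"
    and "i \<in> set M \<Longrightarrow> x < w \<Longrightarrow> \<exists>b c. ((i, x), b, c) \<in> set E"
    and "i \<in> set M \<Longrightarrow> x < w \<Longrightarrow> \<exists>a c. (a, (i, x), c) \<in> set E"
    and "k \<in> set N \<Longrightarrow> x < w \<Longrightarrow> \<exists>a b. (a, b, (k, x)) \<in> set E"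
proof -
  have 1: "inj_on fst (set E)" and 2: "inj_on (\<lambda>e. fst (snd e)) (set E)" and 3: "inj_on (\<lambda>e. snd (snd e)) (set E)"
    and d: "distinct E"
    using assms unfolding cells_ok_def distinct_map by simp_all
  show "distinct E" by (rule d)
  show "((i, x), (j, y), (k, z)) \<in> set E \<Longrightarrow> i < 4 \<and> x < w \<and> j < 4 \<and> y < w \<and> k < 4 \<and> z < w"
    using assms unfolding cells_ok_def by fast
  show "(a, b, c) \<in> set E \<Longrightarrow> (a, b', c') \<in> set E \<Longrightarrow> b = b' \<and> c = c'" using inj_onD[OF 1, of "(a, b, c)" "(a, b', c')"] by simp
  show "(a, b, c) \<in> set E \<Longrightarrow> (a', b, c') \<in> set E \<Longrightarrow> a = a'" using inj_onD[OF 2, of "(a, b, c)" "(a', b, c')"] by simp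
  show "(a, b, c) \<in> set E \<Longrightarrow> (a', b', c) \<in> set E \<Longrightarrow> a = a'" using inj_onD[OF 3, of "(a, b, c)" "(a', b', c)"] by simp
  have c1: "(i, x) \<in> fst ` set E" "(i, x) \<in> (\<lambda>e. fst (snd e)) ` set E" if "i \<in> set M" "x < w" for i x
    using assms that by (simp_all add: cells_ok_def)
  have c2: "(k, x) \<in> (\<lambda>e. snd (snd e)) ` set E" if "k \<in> set N" "x < w" for k x
    using assms that by (simp add: cells_ok_def)
  show "i \<in> set M \<Longrightarrow> x < w \<Longrightarrow> \<exists>b c. ((i, x), b, c) \<in> set E"
    using c1(1)[of i x] by (metis imageE prod.collapse)
  show "i \<in> set M \<Longrightarrow> x < w \<Longrightarrow> \<exists>a c. (a, (i, x), c) \<in> set E"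
    using c1(2)[of i x] by (metis (no_types, lifting) imageE prod.collapse)
  show "k \<in> set N \<Longrightarrow> x < w \<Longrightarrow> \<exists>a b. (a, b, (k, x)) \<in> set E"
    using c2[of k x] by (metis (no_types, lifting) imageE prod.collapse)
qed

context blocks
begin

text \<open>Orbit 0 consists of the special indices, orbit \<open>p + 1\<close> of the pair \<open>s + 2 * p\<close>, \<open>s + 2 * p + 1\<close>.\<close>

definition off :: "nat \<Rightarrow> nat" where "off u = (if u = 0 then 0 else s + 2 * (u - 1))"
definition width :: "nat \<Rightarrow> nat" where "width u = (if u = 0 then s else 2)"
definition enc :: "nat \<Rightarrow> nat \<times> nat \<Rightarrow> nat \<times> nat" where "enc u = (\<lambda>(i, t). (i, off u + t))"

lemma off_inj:
  assumes "t < width u" "t' < width u'" "off u + t = off u' + t'"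
  shows "u = u' \<and> t = t'"
proof -
  have 1: "u = 0 \<longleftrightarrow> off u + t < s" using assms(1) by (auto simp: off_def width_def)
  have 2: "u' = 0 \<longleftrightarrow> off u' + t' < s" using assms(2) by (auto simp: off_def width_def)
  show ?thesis
  proof (cases "u = 0")
    case True
    then have "off u + t < s" using 1 by blast
    then have "off u' + t' < s" unfolding assms(3) .
    then have "u' = 0" using 2 by blast
    then show ?thesis using True assms(3) by (simp add: off_def)
  next
    case False
    then have "\<not> off u + t < s" using 1 by blast
    then have "\<not> off u' + t' < s" unfolding assms(3) .
    then have "u' \<noteq> 0" using 2 by blast
    then obtain v v' where v: "u = Suc v" "u' = Suc v'" using False by (cases u; cases u') auto
    then have "t < 2" "t' < 2" "2 * v + t = 2 * v' + t'" using assms by (simp_all add: off_def width_def)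
    then show ?thesis unfolding v by presburger
  qed
qed

lemma off_cases:
  assumes "z < h"
  obtains u t where "u \<le> g" "t < width u" "z = off u + t"
proof (cases "z < s")
  case True then show thesis using that[of 0 z] by (simp add: off_def width_def)
next
  case False
  then have "z = off (Suc ((z - s) div 2)) + (z - s) mod 2" by (simp add: off_def)
  moreover have "Suc ((z - s) div 2) \<le> g" using False assms h by auto
  ultimately show thesis using that[of "Suc ((z - s) div 2)" "(z - s) mod 2"] by (simp add: width_def)
qed

lemma off_less: "u \<le> g \<Longrightarrow> t < width u \<Longrightarrow> off u + t < h"
  by (auto simp: off_def width_def h)

text \<open>Outside the intercalate, a listed cell lies on the relabelled diagonal of its block,
  where \<open>Q x x = x\<close>. Its symbol then depends on \<open>B\<close> alone, which is why
  one finite table works for every \<open>Q\<close> and every order.\<close>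

lemma special_cells_sym:
  assumes "on_diagonal S" "cells_ok s M N (special_cells B S)" "(a, b, c) \<in> set (special_cells B S)"
  shows "L a b = c"
proof -
  obtain i x j y where e: "(i, x, j, y) \<in> set S" "a = (i, x)" "b = (j, y)"
    "c = (if in_intercalate (i, x) (j, y) then (if i = j then 1 else 0, 2) else (xor i j, B ! i ! j ! x))"
    using assms(3) unfolding special_cells_def by auto
  have x: "x < s" using cells_okD(1)[OF assms(2)] assms(3) e by (metis prod.collapse)
  have "in_intercalate (i, x) (j, y) \<or> relabel_col i j y = x" using assms(1) e(1) by (auto simp: on_diagonal_def)
  then show ?thesis
    using idempotent_latinD(2)[OF Q(1), of x] x h unfolding e(2-4)
    by (auto simp: switched_square_def block_square_def relabel_sym_def)
qed

lemma generic_cells_sym: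
  assumes "cells_ok 2 M N (generic_cells G P)" "(a, b, c) \<in> set (generic_cells G P)" "u \<noteq> 0" "u \<le> g"
  shows "L (enc u a) (enc u b) = enc u c"
proof -
  obtain i t j where e: "(i, t, j) \<in> set P" "a = (i, t)" "b = (j, t)"
    "c = (xor i j, if G ! i ! j = 1 then 1 - t else t)"
    using assms(2) unfolding generic_cells_def by auto
  have t: "t < 2" using cells_okD(1)[OF assms(1)] assms(2) e by (metis prod.collapse)
  have off: "off u = s + 2 * (u - 1)" using assms(3) by (simp add: off_def)
  have lt: "off u + t < h" using off_less[of u t] t assms(3,4) by (simp add: width_def)
  have "Q (off u + t) (off u + t) = off u + t" by (rule idempotent_latinD(2)[OF Q(1) lt])
  moreover have "relabel_col i j (off u + t) = off u + t" using off s3 by (simp add: relabel_col_def)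
  moreover have "relabel_sym s B G i j (off u + t) = off u + (if G ! i ! j = 1 then 1 - t else t)"
    using t off by (auto simp: relabel_sym_def partner_def less_2_cases_iff)
  moreover have "\<not> in_intercalate (i, off u + t) (j, off u + t)" using off s3 by (simp add: in_intercalate_def)
  ultimately show ?thesis
    unfolding e(2-4) by (simp add: switched_square_def block_square_def enc_def)
qed

text \<open>The row, column and symbol of a cell belong to the same orbit, so pieces from different
  orbits never clash, and together they use up the classes in \<open>M\<close> and \<open>N\<close>.
  Cells outside the intercalate are then blocked by \<open>classes_ok\<close>. The switched cells
  carry classes 0 and 1 regardless of their block, so \<open>irr\<close> asks that both classes be
  used up or that both rows of the intercalate be used.\<close>

lemma transversal_of_orbits:
  assumes cls: "classes_ok M N"
    and E: "\<And>u. u \<le> g \<Longrightarrow> cells_ok (width u) M N (E u)"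
    and sym: "\<And>u a b c. u \<le> g \<Longrightarrow> (a, b, c) \<in> set (E u) \<Longrightarrow> L (enc u a) (enc u b) = enc u c"
    and irr: "{0, 1} \<subseteq> set N \<or> (\<forall>i<2. (i, 0) \<in> fst ` set (E 0))"
  shows "\<exists>T. unextendable_pt K K L T \<and> card T = (\<Sum>u\<le>g. length (E u))"
proof -
  define f where "f = (\<lambda>(u, a, b, c). (enc u a, enc u b, enc u c))"
  define S where "S = Sigma {..g} (\<lambda>u. set (E u))"
  define T where "T = f ` S"
  have T: "(x, y, z) \<in> T \<longleftrightarrow> (\<exists>u a b c. u \<le> g \<and> (a, b, c) \<in> set (E u) \<and> x = enc u a \<and> y = enc u b \<and> z = enc u c)" for x y z
  proof
    assume "(x, y, z) \<in> T"
    then show "\<exists>u a b c. u \<le> g \<and> (a, b, c) \<in> set (E u) \<and> x = enc u a \<and> y = enc u b \<and> z = enc u c"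
      unfolding T_def S_def f_def by fastforce
  next
    assume "\<exists>u a b c. u \<le> g \<and> (a, b, c) \<in> set (E u) \<and> x = enc u a \<and> y = enc u b \<and> z = enc u c"
    then obtain u a b c where e: "u \<le> g" "(a, b, c) \<in> set (E u)" "x = enc u a" "y = enc u b" "z = enc u c"
      by blast
    show "(x, y, z) \<in> T"
      unfolding T_def by (rule image_eqI[of _ _ "(u, a, b, c)"]) (use e in \<open>simp_all add: f_def S_def\<close>)
  qed
  have bd: "snd a < width u" "snd b < width u" "snd c < width u" "fst a < 4" "fst b < 4" "fst c < 4"
    if "u \<le> g" "(a, b, c) \<in> set (E u)" for u a b c
    using cells_okD(1)[OF E[OF that(1)], of "fst a" "snd a" "fst b" "snd b" "fst c" "snd c"] that(2) by simp_all
  have einj: "u = u' \<and> a = a'" if "enc u a = enc u' a'" "snd a < width u" "snd a' < width u'" for u u' a a'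
    using that off_inj[of "snd a" u "snd a'" u'] by (cases a; cases a') (simp add: enc_def)
  have eK: "enc u a \<in> K" if "u \<le> g" "fst a < 4" "snd a < width u" for u a
    using off_less[OF that(1,3)] that(2) by (cases a) (simp add: enc_def)
  have "inj_on f S"
  proof (rule inj_onI)
    fix v v' assume v: "v \<in> S" "v' \<in> S" "f v = f v'"
    obtain u a b c u' a' b' c' where e: "v = (u, a, b, c)" "v' = (u', a', b', c')" by (cases v; cases v')
    have m: "u \<le> g" "(a, b, c) \<in> set (E u)" "u' \<le> g" "(a', b', c') \<in> set (E u')"
      using v unfolding e S_def by auto
    have "enc u a = enc u' a'" "enc u b = enc u' b'" "enc u c = enc u' c'" using v(3) unfolding e f_def by simp_all
    then show "v = v'" unfolding e using einj bd[OF m(1,2)] bd[OF m(3,4)] by metis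
  qed
  then have "card T = card S" unfolding T_def by (rule card_image)
  also have "\<dots> = (\<Sum>u\<le>g. card (set (E u)))" unfolding S_def by simp
  also have "\<dots> = (\<Sum>u\<le>g. length (E u))"
    by (rule sum.cong) (auto intro!: distinct_card cells_okD(2)[OF E])
  finally have card: "card T = (\<Sum>u\<le>g. length (E u))" .
  have "unextendable_pt K K L T"
  proof (rule unextendable_ptI)
    fix x y z assume "(x, y, z) \<in> T"
    then obtain u a b c where e: "u \<le> g" "(a, b, c) \<in> set (E u)" "x = enc u a" "y = enc u b" "z = enc u c"
      unfolding T by blast
    show "x \<in> K \<and> y \<in> K \<and> L x y = z"
      unfolding e(3-5) using eK[OF e(1)] bd[OF e(1,2)] sym[OF e(1,2)] by blast
  next
    fix x y z y' z' assume t: "(x, y, z) \<in> T" "(x, y', z') \<in> T"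
    obtain u a b c where e: "u \<le> g" "(a, b, c) \<in> set (E u)" "x = enc u a" "y = enc u b"
      using t(1) unfolding T by blast
    obtain u' a' b' c' where e': "u' \<le> g" "(a', b', c') \<in> set (E u')" "x = enc u' a'" "y' = enc u' b'"
      using t(2) unfolding T by blast
    have "u = u' \<and> a = a'" using einj[of u a u' a'] e(3) e'(3) bd[OF e(1,2)] bd[OF e'(1,2)] by simp
    then show "y = y'" using cells_okD(3)[OF E[OF e(1)] e(2)] e' e(4) by simp
  next
    fix x y z x' z' assume t: "(x, y, z) \<in> T" "(x', y, z') \<in> T"
    obtain u a b c where e: "u \<le> g" "(a, b, c) \<in> set (E u)" "x = enc u a" "y = enc u b"
      using t(1) unfolding T by blast
    obtain u' a' b' c' where e': "u' \<le> g" "(a', b', c') \<in> set (E u')" "x' = enc u' a'" "y = enc u' b'"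
      using t(2) unfolding T by blast
    have "u = u' \<and> b = b'" using einj[of u b u' b'] e(4) e'(4) bd[OF e(1,2)] bd[OF e'(1,2)] by simp
    then show "x = x'" using cells_okD(4)[OF E[OF e(1)] e(2)] e' e(3) by simp
  next
    fix x y z x' y' assume t: "(x, y, z) \<in> T" "(x', y', z) \<in> T"
    obtain u a b c where e: "u \<le> g" "(a, b, c) \<in> set (E u)" "x = enc u a" "z = enc u c"
      using t(1) unfolding T by blast
    obtain u' a' b' c' where e': "u' \<le> g" "(a', b', c') \<in> set (E u')" "x' = enc u' a'" "z = enc u' c'"
      using t(2) unfolding T by blast
    have "u = u' \<and> c = c'" using einj[of u c u' c'] e(4) e'(4) bd[OF e(1,2)] bd[OF e'(1,2)] by simp
    then show "x = x'" using cells_okD(5)[OF E[OF e(1)] e(2)] e' e(3) by simp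
  next
    fix x y assume xy: "x \<in> K" "y \<in> K"
    obtain i p j q where ij: "x = (i, p)" "y = (j, q)" "i < 4" "j < 4" "p < h" "q < h" using xy by (cases x; cases y) auto
    have rowM: "x \<in> rows T" if iM: "i \<in> set M"
    proof -
      obtain u t where u: "u \<le> g" "t < width u" "p = off u + t" using off_cases[OF ij(5)] .
      obtain b c where "((i, t), b, c) \<in> set (E u)" using cells_okD(6)[OF E[OF u(1)] iM u(2)] by blast
      then have "(enc u (i, t), enc u b, enc u c) \<in> T" unfolding T using u(1) by blast
      moreover have "enc u (i, t) = x" using u(3) ij(1) by (simp add: enc_def)
      ultimately have "(x, enc u b, enc u c) \<in> T" by simp
      then show ?thesis unfolding in_rows by blast
    qed
    have colM: "y \<in> cols T" if jM: "j \<in> set M"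
    proof -
      obtain u t where u: "u \<le> g" "t < width u" "q = off u + t" using off_cases[OF ij(6)] .
      obtain b c where "(b, (j, t), c) \<in> set (E u)" using cells_okD(7)[OF E[OF u(1)] jM u(2)] by blast
      then have "(enc u b, enc u (j, t), enc u c) \<in> T" unfolding T using u(1) by blast
      moreover have "enc u (j, t) = y" using u(3) ij(2) by (simp add: enc_def)
      ultimately have "(enc u b, y, enc u c) \<in> T" by simp
      then show ?thesis unfolding in_cols by blast
    qed
    have symN: "v \<in> syms T" if v: "v \<in> K" "fst v \<in> set N" for v
    proof -
      have "snd v < h" using v by auto
      then obtain u t where u: "u \<le> g" "t < width u" "snd v = off u + t" by (rule off_cases)
      obtain a b where "(a, b, (fst v, t)) \<in> set (E u)" using cells_okD(8)[OF E[OF u(1)] v(2) u(2)] by blast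
      moreover have "v = enc u (fst v, t)" using u(3) by (cases v) (simp add: enc_def)
      ultimately show ?thesis using u(1) unfolding in_syms T by blast
    qed
    have LK: "L x y \<in> K" using switched_latin(1) xy by blast
    show "x \<in> rows T \<or> y \<in> cols T \<or> L x y \<in> syms T"
    proof (cases "i \<in> set M \<or> j \<in> set M")
      case True then show ?thesis using rowM colM by blast
    next
      case False
      show ?thesis
      proof (cases "in_intercalate x y")
        case True
        show ?thesis
        proof (cases "{0, 1} \<subseteq> set N")
          case N: True
          have "fst (L x y) \<in> set N" using True N by (auto simp: switched_square_def)
          then show ?thesis using symN[OF LK] by blast
        next
          case False
          have "i < 2" "p = 0" using True unfolding ij by (simp_all add: in_intercalate_def)
          then have "(i, 0) \<in> fst ` set (E 0)" using irr False by blast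
          then obtain b c where "((i, 0), b, c) \<in> set (E 0)" by (metis imageE prod.collapse)
          then have "(enc 0 (i, 0), enc 0 b, enc 0 c) \<in> T" unfolding T by blast
          moreover have "enc 0 (i, 0) = x" using ij(1) \<open>p = 0\<close> by (simp add: enc_def off_def)
          ultimately have "(x, enc 0 b, enc 0 c) \<in> T" by simp
          then show ?thesis unfolding in_rows by blast
        qed
      next
        case no: False
        have "xor i j \<in> set N" using cls False ij(3,4) by (simp add: classes_ok_def)
        then have "fst (L x y) \<in> set N" using no ij by (simp add: switched_square_def block_square_def)
        then show ?thesis using symN[OF LK] by blast
      qed
    qed
  qed
  then show ?thesis using card by blast
qed

lemma transversal_exists:
  assumes cls: "classes_ok M N" and S: "on_diagonal S" "cells_ok s M N (special_cells B S)" "length S + d = 4 * s"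
    and P: "cells_ok 2 M N (generic_cells G P)" "length P = 4"
    and P': "cells_ok 2 M N (generic_cells G P')" "length P' = 8"
    and irr: "{0, 1} \<subseteq> set N \<or> (\<forall>i<2. (i, 0) \<in> fst ` set (special_cells B S))"
    and k: "k \<le> g"
  shows "\<exists>T. unextendable_pt K K L T \<and> card T + (d + 4 * k) = 4 * h"
proof -
  define E where "E u = (if u = 0 then special_cells B S else if u \<le> k then generic_cells G P else generic_cells G P')" for u
  have "\<exists>T. unextendable_pt K K L T \<and> card T = (\<Sum>u\<le>g. length (E u))"
  proof (rule transversal_of_orbits[OF cls])
    show "cells_ok (width u) M N (E u)" for u using S(2) P(1) P'(1) by (simp add: E_def width_def)
    show "L (enc u a) (enc u b) = enc u c" if "u \<le> g" "(a, b, c) \<in> set (E u)" for u a b c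
    proof (cases "u = 0")
      case True
      then show ?thesis using special_cells_sym[OF S(1,2)] that(2)
        by (simp add: E_def enc_def off_def case_prod_unfold)
    next
      case False
      then show ?thesis
        using generic_cells_sym[OF P(1)] generic_cells_sym[OF P'(1)] that by (auto simp: E_def split: if_splits)
    qed
    show "{0, 1} \<subseteq> set N \<or> (\<forall>i<2. (i, 0) \<in> fst ` set (E 0))" using irr by (simp add: E_def)
  qed
  moreover have "(\<Sum>u\<le>g. length (E u)) + (d + 4 * k) = 4 * h"
  proof -
    have "(\<Sum>u\<le>g. length (E u)) = length S + (\<Sum>p<g. if p < k then 4 else 8)"
      unfolding sum.atMost_shift using P(2) P'(2)
      by (simp add: E_def special_cells_def generic_cells_def less_eq_Suc_le) (auto intro!: sum.cong simp: generic_cells_def)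
    moreover have "(\<Sum>p<g. if p < k then 4 else 8 :: nat) + 4 * k = 8 * g"
    proof -
      have "{..<g} \<inter> {p. p < k} = {..<k}" "{..<g} \<inter> - {p. p < k} = {k..<g}" using k by auto
      then show ?thesis using k by (simp add: sum.If_cases)
    qed
    ultimately show ?thesis using S(3) h by simp
  qed
  ultimately show ?thesis by metis
qed

end

text \<open>\<open>SS ! d\<close> leaves \<open>d\<close> special rows unused. A pair of generic indices contributes either \<open>P\<close>, which
  leaves no row unused, or one of \<open>P0\<close> (for even \<open>d\<close>) and \<open>P1\<close> (for odd \<open>d\<close>), which leave four.\<close>

definition data_ok :: "nat \<Rightarrow> nat list list list \<Rightarrow> nat list list \<Rightarrow> nat list \<Rightarrow>
    (nat \<times> nat \<times> nat \<times> nat) list list \<Rightarrow> (nat \<times> nat \<times> nat) list \<Rightarrow> (nat \<times> nat \<times> nat) list \<Rightarrow>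
    (nat \<times> nat \<times> nat) list \<Rightarrow> bool" where
  "data_ok s B G M SS P0 P1 P \<longleftrightarrow> relabelling_ok s B \<and> classes_ok M [0, 1] \<and> classes_ok [0, 2] [0, 2] \<and>
     (\<forall>d\<in>set [0..<2 * s + 1]. let S = SS ! d; E = special_cells B S in
        on_diagonal S \<and> length S + d = 4 * s \<and>
        (if even d then cells_ok s M [0, 1] E
         else cells_ok s [0, 2] [0, 2] E \<and> (0, 0) \<in> set (map fst E) \<and> (1, 0) \<in> set (map fst E))) \<and>
     cells_ok 2 M [0, 1] (generic_cells G P0) \<and> length P0 = 4 \<and>
     cells_ok 2 [0, 2] [0, 2] (generic_cells G P1) \<and> length P1 = 4 \<and>
     cells_ok 2 M [0, 1] (generic_cells G P) \<and> cells_ok 2 [0, 2] [0, 2] (generic_cells G P) \<and> length P = 8"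

lemma omniversal_of_data:
  assumes data: "data_ok s B G M SS P0 P1 P"
  shows "\<exists>L. omniversal (4 * (s + 2 * g)) L"
proof -
  have "relabelling_ok s B" using data by (simp add: data_ok_def)
  then have "3 \<le> s + 2 * g" by (simp add: relabelling_ok_def)
  then obtain Q where Q: "idempotent_latin (s + 2 * g) Q" "Q 0 1 = 2"
    using idempotent_latin_exists by blast
  interpret blocks s g "s + 2 * g" B G Q by unfold_locales (use \<open>relabelling_ok s B\<close> Q in auto)
  have "\<exists>T. unextendable_pt K K L T \<and> card T + d = 4 * (s + 2 * g)" if d: "2 * d \<le> 4 * (s + 2 * g)" for d
  proof -
    \<comment> \<open>Generic orbits absorb as many multiples of 4 as they can. The rest
      \<open>e\<close> is below 4, or at most \<open>2 * s\<close> when all \<open>g\<close> orbits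
      are taken, and it has the parity of \<open>d\<close>, so the special cells can settle
      it.\<close>
    define k where "k = min g (d div 4)"
    define e where "e = d - 4 * k"
    have k: "k \<le> g" "d = e + 4 * k" by (auto simp: k_def e_def)
    have "e \<in> set [0..<2 * s + 1]" using d s3(1) unfolding e_def k_def by (auto simp: min_def) 
    then have S: "on_diagonal (SS ! e)" "length (SS ! e) + e = 4 * s"
      and E: "if even e then cells_ok s M [0, 1] (special_cells B (SS ! e))
         else cells_ok s [0, 2] [0, 2] (special_cells B (SS ! e)) \<and>
           (0, 0) \<in> set (map fst (special_cells B (SS ! e))) \<and> (1, 0) \<in> set (map fst (special_cells B (SS ! e)))"
      using data unfolding data_ok_def Let_def by blast+
    show ?thesis
    proof (cases "even e")
      case True
      then show ?thesis
        using transversal_exists[of M "[0, 1]" "SS ! e" e P0 P k] data S E k unfolding data_ok_def by simp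
    next
      case False
      then have "\<forall>i<2. (i, 0) \<in> fst ` set (special_cells B (SS ! e))" using E by (auto simp: less_2_cases_iff)
      then show ?thesis
        using transversal_exists[of "[0, 2]" "[0, 2]" "SS ! e" e P1 P k] False data S E k
        unfolding data_ok_def by simp
    qed
  qed
  then show ?thesis
    using switched_latin by (intro ex_omniversal[where X = K and Y = K and Z = K and L = L]) auto
qed

text \<open>The tables below and the square of order 8 were found with a SAT solver. There are
  three special indices for odd \<open>h\<close> and four for even \<open>h\<close>, since the others come in pairs.\<close>

lemma data_ok_3: "data_ok 3
   [[[0, 1, 2], [0, 1, 2], [0, 1, 2], [0, 2, 1]], [[0, 1, 2], [2, 1, 0], [0, 1, 2], [0, 1, 2]], [[0, 2,
    1], [0, 1, 2], [1, 0, 2], [1, 0, 2]], [[1, 0, 2], [1, 0, 2], [2, 1, 0], [0, 1, 2]]]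
   [[1, 1, 1, 0], [0, 0, 0, 0], [0, 0, 0, 0], [0, 0, 0, 0]] [0, 1]
   [[(0, 0, 0, 0), (0, 1, 0, 1), (0, 2, 2, 2), (1, 0, 2, 0), (1, 1, 2, 1), (1, 2, 0, 2), (2, 0, 3, 0),
     (2, 1, 3, 1), (2, 2, 1, 2), (3, 0, 1, 0), (3, 1, 1, 1), (3, 2, 3, 2)],
    [(0, 0, 2, 0), (0, 1, 0, 1), (0, 2, 2, 2), (1, 0, 1, 1), (1, 2, 1, 2), (2, 0, 1, 0), (2, 1, 3, 1),
     (2, 2, 0, 2), (3, 0, 0, 0), (3, 1, 2, 1), (3, 2, 3, 2)],
    [(0, 0, 2, 0), (0, 1, 1, 1), (0, 2, 3, 2), (1, 0, 0, 0), (1, 1, 1, 0), (1, 2, 0, 2), (2, 1, 2, 1),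
     (2, 2, 2, 2), (3, 1, 0, 1), (3, 2, 1, 2)],
    [(0, 0, 0, 0), (0, 1, 2, 1), (0, 2, 2, 2), (1, 0, 0, 1), (2, 0, 2, 0), (2, 1, 3, 1), (2, 2, 3, 2),
     (3, 1, 1, 1), (3, 2, 0, 2)],
    [(0, 0, 0, 1), (0, 1, 1, 1), (0, 2, 0, 2), (1, 0, 0, 0), (1, 1, 2, 1), (1, 2, 1, 2), (2, 0, 1, 0),
     (3, 1, 3, 1)],
    [(0, 0, 1, 1), (0, 1, 0, 1), (0, 2, 2, 2), (1, 0, 2, 0), (2, 0, 0, 0), (2, 1, 2, 1), (2, 2, 0, 2)],
    [(0, 0, 0, 1), (0, 1, 1, 1), (0, 2, 0, 2), (1, 0, 0, 0), (1, 1, 1, 0), (1, 2, 1, 2)]]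
   [(0, 0, 0), (0, 1, 1), (1, 0, 1), (1, 1, 0)]
   [(0, 0, 0), (0, 1, 2), (2, 0, 2), (2, 1, 0)]
   [(0, 0, 0), (0, 1, 0), (1, 0, 2), (1, 1, 2), (2, 0, 3), (2, 1, 3), (3, 0, 1), (3, 1, 1)]"
  by code_simp

lemma data_ok_4: "data_ok 4
   [[[0, 1, 2, 3], [0, 1, 2, 3], [3, 2, 0, 1], [0, 3, 2, 1]], [[1, 3, 2, 0], [2, 1, 3, 0], [3, 2, 1,
    0], [2, 1, 3, 0]], [[0, 3, 1, 2], [1, 0, 2, 3], [0, 3, 2, 1], [2, 1, 3, 0]], [[3, 2, 0, 1], [2,
    1, 3, 0], [1, 2, 0, 3], [3, 2, 1, 0]]]
   [[0, 0, 0, 0], [0, 0, 0, 0], [1, 0, 1, 1], [0, 0, 0, 0]] [2, 3]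
   [[(0, 0, 0, 0), (0, 1, 0, 1), (0, 2, 1, 2), (0, 3, 0, 3), (1, 0, 3, 0), (1, 1, 2, 1), (1, 2, 3, 2),
     (1, 3, 3, 3), (2, 0, 1, 0), (2, 1, 1, 1), (2, 2, 0, 2), (2, 3, 1, 3), (3, 0, 2, 0), (3, 1, 3,
     1), (3, 2, 2, 2), (3, 3, 2, 3)],
    [(0, 0, 1, 1), (0, 1, 0, 1), (0, 2, 1, 2), (0, 3, 3, 3), (1, 0, 2, 0), (1, 1, 2, 1), (1, 2, 3, 2),
     (1, 3, 1, 3), (2, 0, 0, 0), (2, 1, 3, 1), (2, 2, 0, 2), (2, 3, 0, 3), (3, 0, 3, 0), (3, 2, 2,
     2), (3, 3, 2, 3)],
    [(0, 0, 3, 0), (0, 1, 1, 1), (0, 3, 0, 3), (1, 0, 2, 0), (1, 1, 3, 1), (1, 3, 1, 3), (2, 0, 0, 0),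
     (2, 1, 0, 1), (2, 2, 2, 2), (2, 3, 3, 3), (3, 0, 1, 0), (3, 1, 2, 1), (3, 2, 3, 2), (3, 3, 2,
     3)],
    [(0, 0, 1, 1), (0, 1, 3, 1), (0, 2, 2, 2), (0, 3, 1, 3), (1, 0, 0, 0), (1, 1, 2, 1), (1, 2, 1, 2),
     (1, 3, 2, 3), (2, 0, 2, 0), (2, 1, 0, 1), (2, 2, 0, 2), (2, 3, 0, 3), (3, 2, 3, 2)],
    [(0, 0, 1, 1), (0, 1, 2, 1), (1, 2, 0, 2), (1, 3, 3, 3), (2, 0, 2, 0), (2, 1, 3, 1), (2, 2, 3, 2),
     (2, 3, 2, 3), (3, 0, 3, 0), (3, 1, 0, 1), (3, 2, 2, 2), (3, 3, 0, 3)],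
    [(0, 0, 1, 1), (0, 1, 2, 1), (0, 2, 2, 2), (0, 3, 0, 3), (1, 0, 0, 0), (1, 1, 3, 1), (1, 2, 0, 2),
     (2, 0, 2, 0), (2, 1, 0, 1), (2, 2, 3, 2), (2, 3, 2, 3)],
    [(1, 0, 0, 1), (1, 3, 3, 3), (2, 0, 2, 0), (2, 1, 3, 1), (2, 2, 3, 2), (2, 3, 2, 3), (3, 0, 3, 0),
     (3, 1, 2, 1), (3, 2, 2, 2), (3, 3, 0, 3)],
    [(0, 0, 1, 1), (0, 1, 2, 1), (0, 2, 2, 2), (0, 3, 0, 3), (1, 0, 0, 0), (2, 0, 2, 0), (2, 1, 0, 1),
     (2, 2, 0, 2), (2, 3, 2, 3)],
    [(2, 0, 2, 0), (2, 1, 3, 1), (2, 2, 2, 2), (2, 3, 3, 3), (3, 0, 3, 0), (3, 1, 2, 1), (3, 2, 3, 2),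
     (3, 3, 2, 3)]]
   [(2, 0, 2), (2, 1, 3), (3, 0, 3), (3, 1, 2)]
   [(2, 0, 2), (2, 1, 0), (0, 0, 0), (0, 1, 2)]
   [(2, 0, 2), (2, 1, 2), (3, 0, 0), (3, 1, 0), (0, 0, 1), (0, 1, 1), (1, 0, 3), (1, 1, 3)]"
  by code_simp

section \<open>Orders 8 and 1\<close>

definition table_latin :: "nat \<Rightarrow> nat list list \<Rightarrow> bool" where
  "table_latin n M \<longleftrightarrow> (\<forall>r\<in>set [0..<n]. \<forall>c\<in>set [0..<n]. M ! r ! c < n) \<and>
     (\<forall>r\<in>set [0..<n]. distinct (map (\<lambda>c. M ! r ! c) [0..<n])) \<and>
     (\<forall>c\<in>set [0..<n]. distinct (map (\<lambda>r. M ! r ! c) [0..<n]))"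

definition table_unextendable :: "nat \<Rightarrow> nat list list \<Rightarrow> (nat \<times> nat) list \<Rightarrow> bool" where
  "table_unextendable n M P \<longleftrightarrow> (\<forall>(r, c) \<in> set P. r < n \<and> c < n) \<and>
     distinct (map fst P) \<and> distinct (map snd P) \<and> distinct (map (\<lambda>(r, c). M ! r ! c) P) \<and>
     (\<forall>r\<in>set [0..<n]. \<forall>c\<in>set [0..<n]. r \<in> set (map fst P) \<or> c \<in> set (map snd P) \<or>
        M ! r ! c \<in> set (map (\<lambda>(r, c). M ! r ! c) P))"

lemma table_latin:
  assumes "table_latin n M"
  shows "latin_square n (\<lambda>r c. M ! r ! c)"
  by (rule latin_squareI) (use assms in \<open>simp_all add: table_latin_def distinct_map atLeast0LessThan\<close>)

lemma table_unextendable: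
  assumes "table_unextendable n M P"
  shows "\<exists>T. unextendable_pt {..<n} {..<n} (\<lambda>r c. M ! r ! c) T \<and> card T = length P"
proof -
  define f where "f = (\<lambda>(r, c). (r, c, M ! r ! c))"
  have 1: "inj_on fst (set P)" and 2: "inj_on snd (set P)" and 3: "inj_on (\<lambda>(r, c). M ! r ! c) (set P)"
    and d: "distinct P" and lt: "\<And>r c. (r, c) \<in> set P \<Longrightarrow> r < n \<and> c < n"
    using assms unfolding table_unextendable_def distinct_map by auto
  have all: "\<forall>r\<in>set [0..<n]. \<forall>c\<in>set [0..<n]. r \<in> set (map fst P) \<or> c \<in> set (map snd P) \<or>
        M ! r ! c \<in> set (map (\<lambda>(r, c). M ! r ! c) P)"
    using assms unfolding table_unextendable_def by blast
  have ex: "r \<in> fst ` set P \<or> c \<in> snd ` set P \<or> M ! r ! c \<in> (\<lambda>(r, c). M ! r ! c) ` set P"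
    if "r < n" "c < n" for r c
    using bspec[OF bspec[OF all, of r], of c] that by simp
  have T: "(x, y, z) \<in> f ` set P \<longleftrightarrow> (x, y) \<in> set P \<and> z = M ! x ! y" for x y z
    unfolding f_def by (auto intro: image_eqI[of _ _ "(x, y)"])
  have "unextendable_pt {..<n} {..<n} (\<lambda>r c. M ! r ! c) (f ` set P)"
  proof (rule unextendable_ptI)
    show "x \<in> {..<n} \<and> y \<in> {..<n} \<and> M ! x ! y = z" if "(x, y, z) \<in> f ` set P" for x y z
      using that lt[of x y] unfolding T by auto
    show "y = y'" if "(x, y, z) \<in> f ` set P" "(x, y', z') \<in> f ` set P" for x y z y' z'
      using that inj_onD[OF 1, of "(x, y)" "(x, y')"] unfolding T by simp
    show "x = x'" if "(x, y, z) \<in> f ` set P" "(x', y, z') \<in> f ` set P" for x y z x' z'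
      using that inj_onD[OF 2, of "(x, y)" "(x', y)"] unfolding T by simp
    show "x = x'" if "(x, y, z) \<in> f ` set P" "(x', y', z) \<in> f ` set P" for x y z x' y'
      using that inj_onD[OF 3, of "(x, y)" "(x', y')"] unfolding T by simp
    fix x y assume "x \<in> {..<n}" "y \<in> {..<n}"
    then consider "x \<in> fst ` set P" | "y \<in> snd ` set P" | "M ! x ! y \<in> (\<lambda>(r, c). M ! r ! c) ` set P"
      using ex by blast
    then show "x \<in> rows (f ` set P) \<or> y \<in> cols (f ` set P) \<or> M ! x ! y \<in> syms (f ` set P)"
      unfolding in_rows in_cols in_syms T by cases auto
  qed
  moreover have "card (f ` set P) = length P"
    using d by (subst card_image) (auto simp: f_def inj_on_def distinct_card)
  ultimately show ?thesis by blast
qed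

text \<open>Blocks of order 2 are out of reach of the construction above, since no idempotent Latin
  square of order 2 exists.\<close>

lemma omniversal_8: "\<exists>L. omniversal 8 L"
proof -
  \<comment> \<open>The table consists of four subsquares of order 4, as a maximal partial
    transversal of length 4 forces by \<open>half_length_structure\<close>.\<close>
  define M :: "nat list list" where "M =
    [[0, 1, 2, 3, 4, 5, 6, 7], [1, 0, 3, 2, 5, 7, 4, 6], [2, 3, 1, 0, 7, 6, 5, 4], [3, 2, 0, 1, 6, 4, 7, 5],
     [4, 5, 7, 6, 2, 3, 1, 0], [5, 7, 6, 4, 3, 2, 0, 1], [6, 4, 5, 7, 1, 0, 2, 3], [7, 6, 4, 5, 0, 1, 3, 2]]"
  define PP :: "(nat \<times> nat) list list" where "PP =
    [[(0, 4), (1, 0), (2, 5), (3, 1), (4, 2), (5, 6), (6, 7), (7, 3)],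
     [(0, 2), (1, 7), (2, 6), (3, 3), (4, 5), (6, 1), (7, 0)],
     [(0, 7), (1, 2), (2, 6), (3, 5), (6, 4), (7, 1)],
     [(0, 2), (1, 6), (2, 4), (6, 7), (7, 3)],
     [(4, 7), (5, 5), (6, 4), (7, 6)]]"
  have M: "table_latin 8 M" unfolding M_def by code_simp
  have P: "\<forall>d\<in>set [0..<5]. table_unextendable 8 M (PP ! d) \<and> length (PP ! d) + d = 8"
    unfolding M_def PP_def by code_simp
  have "latin_square 8 (\<lambda>r c. M ! r ! c)" using M by (rule table_latin)
  moreover have "\<exists>T. unextendable_pt {..<8} {..<8} (\<lambda>r c. M ! r ! c) T \<and> card T + d = 8" if "2 * d \<le> 8" for d
  proof -
    have "d \<in> set [0..<5]" using that by auto
    then have "table_unextendable 8 M (PP ! d)" "length (PP ! d) + d = 8" using P by blast+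
    then show ?thesis using table_unextendable by metis
  qed
  ultimately show ?thesis unfolding omniversal_iff by blast
qed

lemma omniversal_1: "\<exists>L. omniversal 1 L"
proof -
  have "unextendable_pt {..<1} {..<1} (\<lambda>_ _. 0) {(0::nat, 0::nat, 0::nat)}"
    by (simp add: unextendable_pt_def)
  moreover have "latin_square 1 (\<lambda>_ _. 0)"
    by (rule latin_squareI) (auto simp: inj_on_def)
  ultimately have "omniversal 1 (\<lambda>_ _. 0)"
    unfolding omniversal_iff by (auto intro!: exI[of _ "{(0, 0, 0)}"])
  then show ?thesis by blast
qed

theorem theorem1p3:
  fixes n :: nat
  assumes "n > 0"
  shows "(\<exists>L. omniversal n L) \<longleftrightarrow> n \<notin> {3, 4} \<and> n mod 4 \<noteq> 2"
proof
  assume "\<exists>L. omniversal n L"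
  then obtain L where L: "omniversal n L" by blast
  have "n \<noteq> 3" "n \<noteq> 4" using L no_omniversal_3 no_omniversal_4 by metis+
  moreover have "n mod 4 \<noteq> 2" using L no_omniversal_2_mod_4 by blast
  ultimately show "n \<notin> {3, 4} \<and> n mod 4 \<noteq> 2" by blast
next
  assume *: "n \<notin> {3, 4} \<and> n mod 4 \<noteq> 2"
  then consider "n = 1" | "n = 8" | g where "g > 0" "n = 4 * g + 1" | g where "g > 0" "n = 4 * g + 3"
    | g where "n = 4 * (3 + 2 * g)" | g where "n = 4 * (4 + 2 * g)"
  proof -
    assume **: "n = 1 \<Longrightarrow> thesis" "n = 8 \<Longrightarrow> thesis" "\<And>g. g > 0 \<Longrightarrow> n = 4 * g + 1 \<Longrightarrow> thesis"
      "\<And>g. g > 0 \<Longrightarrow> n = 4 * g + 3 \<Longrightarrow> thesis" "\<And>g. n = 4 * (3 + 2 * g) \<Longrightarrow> thesis"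
      "\<And>g. n = 4 * (4 + 2 * g) \<Longrightarrow> thesis"
    define q where "q = n div 4"
    have "n mod 4 = 0 \<or> n mod 4 = 1 \<or> n mod 4 = 3" using * by linarith
    then have "n = 4 * q \<or> n = 4 * q + 1 \<or> n = 4 * q + 3" unfolding q_def by presburger
    then show thesis
    proof (elim disjE)
      assume n: "n = 4 * q"
      then have "q \<noteq> 0" "q \<noteq> 1" using assms * by auto
      \<comment> \<open>Odd \<open>q\<close> takes three special indices and even \<open>q\<close>
        from 4 on takes four; \<open>q = 2\<close> is left to the explicit table.\<close>
      then have "q = 2 \<or> q = 3 + 2 * ((q - 3) div 2) \<or> q = 4 + 2 * ((q - 4) div 2)" by presburger
      then show thesis
      proof (elim disjE)
        assume "q = 2"
        then show thesis using **(2) n by simp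
      next
        assume "q = 3 + 2 * ((q - 3) div 2)"
        then show thesis using **(5)[of "(q - 3) div 2"] n by simp
      next
        assume "q = 4 + 2 * ((q - 4) div 2)"
        then show thesis using **(6)[of "(q - 4) div 2"] n by simp
      qed
    next
      assume "n = 4 * q + 1"
      then show thesis using **(1) **(3)[of q] by (cases "q = 0") auto
    next
      assume "n = 4 * q + 3"
      then show thesis using **(4)[of q] * by (cases "q = 0") auto
    qed
  qed
  then show "\<exists>L. omniversal n L"
  proof cases
    case 1 then show ?thesis using omniversal_1 by simp
  next
    case 2 then show ?thesis using omniversal_8 by simp
  next
    case 3 then show ?thesis using omniversal_4g1 by simp
  next
    case 4 then show ?thesis using omniversal_4g3 by simp
  next
    case 5 then show ?thesis using omniversal_of_data[OF data_ok_3] by simp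
  next
    case 6 then show ?thesis using omniversal_of_data[OF data_ok_4] by simp
  qed
qed

end
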